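(* Let $T>0$ and $\theta>2$. The problem $$u_{tt}-(x^\theta u_x)_x=0\ \text{ in }]0,T[\times]0,1[,\qquad u(t,1)=0,\quad\lim_{x\downarrow0}x^\theta u_x(t,x)=0\ \ (0<t<T),\qquad u(0,\cdot)=u_0,\ u_t(0,\cdot)=u_1,$$ is not observable on $[0,T]$ via the normal derivative $u_x(\cdot,1)$: there exist smooth functions $u_0,u_1$ with compact support in $]0,1[$, not both identically zero, such that the corresponding solution satisfies $u_x(t,1)=0$ for all $t\in[0,T]$; consequently there is no constant $C>0$ such that $\int_0^Tu_x^2(t,1)\,dt\geqslant C\,E_u(0)$ for all solutions $u$ with smooth compactly supported data.
   Context: The energy is $E_u(t)=\frac12\int_0^1\{u_t^2(t,x)+x^\theta u_x^2(t,x)\}dx$. Solutions are understood in the classical sense (the data being smooth with compact support in $]0,1[$). *)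

theory Defs
  imports "HOL-Analysis.Analysis"
begin

text \<open>
  Functions of \<open>(t, x)\<close> are curried, and only their values on \<open>[0,T] \<times> ]0,1]\<close> matter. Partial
  derivatives are taken within that set: they are the ordinary ones at interior points, and
  one-sided at \<open>t = 0\<close>, \<open>t = T\<close> and \<open>x = 1\<close>.
\<close>

definition dt :: "real \<Rightarrow> (real \<Rightarrow> real \<Rightarrow> real) \<Rightarrow> real \<Rightarrow> real \<Rightarrow> real" where
  "dt T u t x = vector_derivative (\<lambda>s. u s x) (at t within {0..T})"

definition dx :: "(real \<Rightarrow> real \<Rightarrow> real) \<Rightarrow> real \<Rightarrow> real \<Rightarrow> real" where
  "dx u t x = vector_derivative (\<lambda>y. u t y) (at x within {0<..1})"

definition C1_on_strip :: "real \<Rightarrow> (real \<Rightarrow> real \<Rightarrow> real) \<Rightarrow> bool" where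
  "C1_on_strip T u \<longleftrightarrow>
     (\<forall>t\<in>{0..T}. \<forall>x\<in>{0<..1}.
        (\<lambda>s. u s x) differentiable (at t within {0..T}) \<and>
        (\<lambda>y. u t y) differentiable (at x within {0<..1})) \<and>
     continuous_on ({0..T} \<times> {0<..1}) (\<lambda>(t, x). u t x) \<and>
     continuous_on ({0..T} \<times> {0<..1}) (\<lambda>(t, x). dt T u t x) \<and>
     continuous_on ({0..T} \<times> {0<..1}) (\<lambda>(t, x). dx u t x)"

definition C2_on_strip :: "real \<Rightarrow> (real \<Rightarrow> real \<Rightarrow> real) \<Rightarrow> bool" where
  "C2_on_strip T u \<longleftrightarrow> C1_on_strip T u \<and> C1_on_strip T (dt T u) \<and> C1_on_strip T (dx u)"

text \<open>
  Smooth functions with compact support in \<open>]0,1[\<close>, extended by zero to the whole line.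
\<close>

definition test_function :: "(real \<Rightarrow> real) \<Rightarrow> bool" where
  "test_function f \<longleftrightarrow>
     (\<forall>n x. (deriv ^^ n) f differentiable (at x)) \<and>
     compact (closure {x. f x \<noteq> 0}) \<and> closure {x. f x \<noteq> 0} \<subseteq> {0<..<1}"

definition classical_solution ::
  "real \<Rightarrow> real \<Rightarrow> (real \<Rightarrow> real) \<Rightarrow> (real \<Rightarrow> real) \<Rightarrow> (real \<Rightarrow> real \<Rightarrow> real) \<Rightarrow> bool" where
  "classical_solution T \<theta> u0 u1 u \<longleftrightarrow>
     C2_on_strip T u \<and>
     (\<forall>t\<in>{0<..<T}. \<forall>x\<in>{0<..<1}.
        dt T (dt T u) t x - dx (\<lambda>s y. y powr \<theta> * dx u s y) t x = 0) \<and>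
     (\<forall>t\<in>{0<..<T}. u t 1 = 0) \<and>
     (\<forall>t\<in>{0<..<T}. ((\<lambda>x. x powr \<theta> * dx u t x) \<longlongrightarrow> 0) (at_right 0)) \<and>
     (\<forall>x\<in>{0<..<1}. u 0 x = u0 x \<and> dt T u 0 x = u1 x)"

definition energy :: "real \<Rightarrow> real \<Rightarrow> (real \<Rightarrow> real \<Rightarrow> real) \<Rightarrow> real \<Rightarrow> real" where
  "energy T \<theta> u t =
     1/2 * integral {0<..<1} (\<lambda>x. (dt T u t x)\<^sup>2 + x powr \<theta> * (dx u t x)\<^sup>2)"

end

theory Submission
  imports Defs
begin

text \<open>
  Signals travel at speed \<open>x powr (\<theta> / 2)\<close>, so in the travel-time coordinate
  \<open>z = x powr (1 - \<theta> / 2) / (\<theta> / 2 - 1)\<close> they have speed one. As \<open>\<theta> > 2\<close>, the degenerate end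
  \<open>x = 0\<close> lies at \<open>z = \<infinity>\<close>: the problem lives on a half line \<open>z \<ge> m\<close>, with the observer at
  \<open>z = m\<close>, and a wave that starts at distance more than \<open>T\<close> from \<open>m\<close> is not seen before time \<open>T\<close>.
  Nor has it reached \<open>z = \<infinity>\<close> by then, so the condition at \<open>x = 0\<close> holds trivially.

  What has to be produced is such a wave, together with its uniqueness. With
  \<open>u = x powr (- \<theta> / 4) * w\<close> the equation becomes \<open>w_tt = w_zz - \<mu> / z\<^sup>2 * w\<close>. For data
  \<open>w = 0\<close>, \<open>w_t = f\<close> Riemann's method gives the explicit solution
  \<open>w(t,z) = 1/2 \<integral> G((t\<^sup>2 - (z - y)\<^sup>2) / (4 z y)) f(y) dy\<close>, integrated over
  \<open>\<bar>y - z\<bar> \<le> t\<close>, where \<open>G\<close> is a hypergeometric function with \<open>G 0 = 1\<close>. The support of \<open>f\<close> can be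
  chosen: if it lies far enough out, the argument of \<open>G\<close> stays inside the disc of
  convergence of its power series at zero, and \<open>G\<close> can be taken to be that series. The local
  solution is \<open>bessel_wave_local\<close>; since it vanishes off the domain of influence of \<open>f\<close>,
  it extends by zero (\<open>compact_wave_exists\<close>), and \<open>unobservable_wave\<close> carries it back to \<open>x\<close>.

  Uniqueness (\<open>classical_solution_unique\<close>) must cover solutions whose energy near \<open>x = 0\<close>
  may be infinite. It is an energy estimate with the weight \<open>cutoff Z (t + z)\<close>, which restricts the energy to
  a backward cone. As \<open>z\<close> is unbounded, every point of the strip lies in such a cone
  that stays away from \<open>x = 0\<close>.

  The solution found has \<open>u_0 = 0\<close> and \<open>u_1 \<noteq> 0\<close>, hence positive energy and zero observation,
  which excludes every constant \<open>C\<close>.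
\<close>

section \<open>Bump functions\<close>

text \<open>
  Bump functions come from the classical \<open>exp (- 1 / x)\<close>. The factor \<open>x powr (- k)\<close> is included so
  that the family is closed under differentiation up to linear combinations.
\<close>

definition flat :: "nat \<Rightarrow> real \<Rightarrow> real" where
  "flat k x = (if x > 0 then inverse x ^ k * exp (- inverse x) else 0)"

lemma flat_tendsto_0: "(flat k \<longlongrightarrow> 0) (at_right 0)"
proof -
  have "((\<lambda>y::real. y ^ k / exp y) \<longlongrightarrow> 0) at_top"
    by (rule tendsto_power_div_exp_0)
  then have "((\<lambda>x::real. inverse x ^ k / exp (inverse x)) \<longlongrightarrow> 0) (at_right 0)"
    by (rule filterlim_compose[OF _ filterlim_inverse_at_top_right])
  moreover have "\<forall>\<^sub>F x in at_right 0. inverse x ^ k / exp (inverse x) = flat k x"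
    unfolding eventually_at_right_field
    by (intro exI[of _ 1]) (auto simp: flat_def exp_minus divide_inverse)
  ultimately show ?thesis
    by (rule Lim_transform_eventually)
qed

lemma DERIV_flat:
  "(flat k has_real_derivative (flat (k + 2) x - k * flat (k + 1) x)) (at x)"
proof -
  consider "x > 0" | "x < 0" | "x = 0" by linarith
  then show ?thesis
  proof cases
    case 1
    have "((\<lambda>x. inverse x ^ k * exp (- inverse x)) has_real_derivative
        flat (k + 2) x - k * flat (k + 1) x) (at x)"
      using 1
      by (auto intro!: derivative_eq_intros simp: flat_def power_inverse)
        (cases k; simp add: field_simps)
    then show ?thesis
      by (rule has_field_derivative_transform_within_open[where S="{0<..}"])
        (use 1 in \<open>auto simp: flat_def\<close>)
  next
    case 2
    have "((\<lambda>x. 0) has_real_derivative 0) (at x)" by simp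
    then have "(flat k has_real_derivative 0) (at x)"
      by (rule has_field_derivative_transform_within_open[where S="{..<0}"])
        (use 2 in \<open>auto simp: flat_def\<close>)
    then show ?thesis using 2 by (simp add: flat_def)
  next
    case 3
    have l: "((\<lambda>y. (flat k y - flat k 0) / (y - 0)) \<longlongrightarrow> 0) (at_right 0)"
    proof (rule Lim_transform_eventually[OF flat_tendsto_0[of "Suc k"]])
      show "\<forall>\<^sub>F y in at_right 0. flat (Suc k) y = (flat k y - flat k 0) / (y - 0)"
        unfolding eventually_at_right_field
        by (intro exI[of _ 1]) (auto simp: flat_def field_simps)
    qed
    have r: "((\<lambda>y. (flat k y - flat k 0) / (y - 0)) \<longlongrightarrow> 0) (at_left 0)"
    proof (rule Lim_transform_eventually[OF tendsto_const])
      show "\<forall>\<^sub>F y in at_left 0. 0 = (flat k y - flat k 0) / (y - 0)"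
        unfolding eventually_at_left_field
        by (intro exI[of _ "-1"]) (auto simp: flat_def)
    qed
    have "((\<lambda>y. (flat k y - flat k 0) / (y - 0)) \<longlongrightarrow> 0) (at 0)"
      by (rule filterlim_split_at[OF r l])
    then show ?thesis
      using 3 by (simp add: has_field_derivative_iff flat_def)
  qed
qed

text \<open>
  Smoothness is shown without a formula for the higher derivatives: the span of the products
  \<open>flat j (x - a) * flat k (b - x)\<close> consists of differentiable functions and contains their derivatives.
\<close>

inductive bump_span :: "real \<Rightarrow> real \<Rightarrow> (real \<Rightarrow> real) \<Rightarrow> bool" for a b where
  gen: "bump_span a b (\<lambda>x. flat j (x - a) * flat k (b - x))"
| add: "bump_span a b f \<Longrightarrow> bump_span a b g \<Longrightarrow> bump_span a b (\<lambda>x. f x + g x)"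
| scale: "bump_span a b f \<Longrightarrow> bump_span a b (\<lambda>x. c * f x)"

lemma bump_span_deriv:
  "bump_span a b f \<Longrightarrow> \<exists>g. bump_span a b g \<and> (\<forall>x. (f has_real_derivative g x) (at x))"
proof (induction rule: bump_span.induct)
  case (gen j k)
  let ?G = "\<lambda>x. (flat (j + 2) (x - a) * flat k (b - x) + (- real j) * (flat (j + 1) (x - a) * flat k (b - x)))
     + ((-1) * (flat j (x - a) * flat (k + 2) (b - x)) + real k * (flat j (x - a) * flat (k + 1) (b - x)))"
  have "bump_span a b ?G"
    by (intro bump_span.intros)
  moreover have "((\<lambda>x. flat j (x - a) * flat k (b - x)) has_real_derivative ?G x) (at x)" for x
    by (rule derivative_eq_intros DERIV_chain2[OF DERIV_flat] refl)+ (simp add: algebra_simps)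
  ultimately show ?case by blast
next
  case (add f g)
  then obtain f' g' where "bump_span a b f'" "bump_span a b g'"
    "\<forall>x. (f has_real_derivative f' x) (at x)" "\<forall>x. (g has_real_derivative g' x) (at x)" by blast
  then show ?case
    by (intro exI[of _ "\<lambda>x. f' x + g' x"]) (auto intro!: bump_span.intros derivative_intros)
next
  case (scale f c)
  then obtain f' where "bump_span a b f'" "\<forall>x. (f has_real_derivative f' x) (at x)" by blast
  then show ?case
    by (intro exI[of _ "\<lambda>x. c * f' x"]) (auto intro!: bump_span.intros DERIV_cmult)
qed

lemma bump_span_higher_deriv: "bump_span a b f \<Longrightarrow> bump_span a b ((deriv ^^ n) f)"
proof (induction n)
  case (Suc n)
  then obtain g where g: "bump_span a b g" "\<forall>x. ((deriv ^^ n) f has_real_derivative g x) (at x)"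
    using bump_span_deriv by blast
  then have "deriv ((deriv ^^ n) f) = g"
    by (auto intro!: DERIV_imp_deriv)
  with g show ?case by simp
qed simp

lemma test_function_bump:
  assumes "0 < a" "a < b" "b < 1"
  shows "test_function (\<lambda>x. flat 0 (x - a) * flat 0 (b - x))"
proof -
  let ?f = "\<lambda>x. flat 0 (x - a) * flat 0 (b - x)"
  have supp: "{x. ?f x \<noteq> 0} = {a<..<b}"
    by (auto simp: flat_def)
  have "(deriv ^^ n) ?f differentiable (at x)" for n x
    using bump_span_deriv[OF bump_span_higher_deriv[OF bump_span.gen]]
    by (meson real_differentiable_def)
  then show ?thesis
    unfolding test_function_def supp using assms by auto
qed

lemma test_function_0: "test_function (\<lambda>x. 0)"
proof -
  have "(deriv ^^ n) (\<lambda>x. 0) = (\<lambda>x::real. 0::real)" for n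
    by (induction n) (auto simp: deriv_const)
  then show ?thesis by (simp add: test_function_def)
qed

section \<open>Continuously differentiable functions of two variables\<close>

text \<open>
  A relational form of being \<open>C\<^sup>1\<close> on a product set: \<open>p\<close> and \<open>q\<close> are given functions, so they can be
  transformed by formulas and differentiated again. Derivatives within the set are
  one-sided on the edges \<open>t = 0\<close>, \<open>t = T\<close>, \<open>x = 1\<close> of the strip.
\<close>

definition partials_on ::
  "real set \<Rightarrow> real set \<Rightarrow> (real \<Rightarrow> real \<Rightarrow> real) \<Rightarrow> (real \<Rightarrow> real \<Rightarrow> real) \<Rightarrow> (real \<Rightarrow> real \<Rightarrow> real) \<Rightarrow> bool" where
  "partials_on A B u p q \<longleftrightarrow>
     (\<forall>t\<in>A. \<forall>x\<in>B. ((\<lambda>s. u s x) has_real_derivative p t x) (at t within A) \<and>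
                 ((\<lambda>y. u t y) has_real_derivative q t x) (at x within B)) \<and>
     continuous_on (A \<times> B) (\<lambda>(t, x). u t x) \<and>
     continuous_on (A \<times> B) (\<lambda>(t, x). p t x) \<and>
     continuous_on (A \<times> B) (\<lambda>(t, x). q t x)"

lemma DERIV_cong_on:
  assumes "x \<in> S" "\<And>y. y \<in> S \<Longrightarrow> g y = f y" "(f has_real_derivative D) (at x within S)"
  shows "(g has_real_derivative D) (at x within S)"
  using assms unfolding has_field_derivative_def by (rule has_derivative_transform)

lemma partials_onD:
  assumes "partials_on A B u p q"
  shows "t \<in> A \<Longrightarrow> x \<in> B \<Longrightarrow> ((\<lambda>s. u s x) has_real_derivative p t x) (at t within A)"
    and "t \<in> A \<Longrightarrow> x \<in> B \<Longrightarrow> ((\<lambda>y. u t y) has_real_derivative q t x) (at x within B)"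
    and "continuous_on (A \<times> B) (\<lambda>(t, x). u t x)"
    and "continuous_on (A \<times> B) (\<lambda>(t, x). p t x)"
    and "continuous_on (A \<times> B) (\<lambda>(t, x). q t x)"
  using assms by (auto simp: partials_on_def)

lemma partials_on_cong:
  assumes "partials_on A B u p q"
    and "\<And>t x. t \<in> A \<Longrightarrow> x \<in> B \<Longrightarrow> u t x = u' t x"
    and "\<And>t x. t \<in> A \<Longrightarrow> x \<in> B \<Longrightarrow> p t x = p' t x"
    and "\<And>t x. t \<in> A \<Longrightarrow> x \<in> B \<Longrightarrow> q t x = q' t x"
  shows "partials_on A B u' p' q'"
  unfolding partials_on_def
proof (intro conjI ballI)
  fix t x assume tx: "t \<in> A" "x \<in> B"
  show "((\<lambda>s. u' s x) has_real_derivative p' t x) (at t within A)"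
    by (rule DERIV_cong_on[OF tx(1)])
      (use assms tx partials_onD(1)[OF assms(1) tx] in auto)
  show "((\<lambda>y. u' t y) has_real_derivative q' t x) (at x within B)"
    by (rule DERIV_cong_on[OF tx(2)])
      (use assms tx partials_onD(2)[OF assms(1) tx] in auto)
next
  show "continuous_on (A \<times> B) (\<lambda>(t, x). u' t x)"
    by (rule continuous_on_eq[OF partials_onD(3)[OF assms(1)]]) (use assms in auto)
  show "continuous_on (A \<times> B) (\<lambda>(t, x). p' t x)"
    by (rule continuous_on_eq[OF partials_onD(4)[OF assms(1)]]) (use assms in auto)
  show "continuous_on (A \<times> B) (\<lambda>(t, x). q' t x)"
    by (rule continuous_on_eq[OF partials_onD(5)[OF assms(1)]]) (use assms in auto)
qed

lemma partials_on_mono: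
  assumes "partials_on A B u p q" "A' \<subseteq> A" "B' \<subseteq> B"
  shows "partials_on A' B' u p q"
proof -
  have "A' \<times> B' \<subseteq> A \<times> B" using assms by auto
  then show ?thesis
    using assms continuous_on_subset DERIV_subset unfolding partials_on_def by (meson subsetD)
qed

lemma partials_on_add:
  assumes "partials_on A B u p q" "partials_on A B u' p' q'"
  shows "partials_on A B (\<lambda>t x. u t x + u' t x) (\<lambda>t x. p t x + p' t x) (\<lambda>t x. q t x + q' t x)"
  using assms unfolding partials_on_def case_prod_unfold
  by (auto intro!: DERIV_add continuous_on_add)

lemma partials_on_cmult:
  assumes "partials_on A B u p q"
  shows "partials_on A B (\<lambda>t x. c * u t x) (\<lambda>t x. c * p t x) (\<lambda>t x. c * q t x)"
  using assms unfolding partials_on_def case_prod_unfold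
  by (auto intro!: DERIV_cmult continuous_on_mult_left)

lemma partials_on_diff:
  assumes "partials_on A B u p q" "partials_on A B u' p' q'"
  shows "partials_on A B (\<lambda>t x. u t x - u' t x) (\<lambda>t x. p t x - p' t x) (\<lambda>t x. q t x - q' t x)"
  using partials_on_add[OF assms(1) partials_on_cmult[OF assms(2), of "-1"]] by simp

lemma continuous_on_compose_pair:
  assumes "continuous_on (A \<times> B) (\<lambda>(t, x). u t x)" "continuous_on S f" "continuous_on S g"
    "\<And>s. s \<in> S \<Longrightarrow> f s \<in> A" "\<And>s. s \<in> S \<Longrightarrow> g s \<in> B"
  shows "continuous_on S (\<lambda>s. u (f s) (g s))"
  using continuous_on_compose2[OF assms(1) continuous_on_Pair[OF assms(2,3)]] assms(4,5) by auto

lemma partials_on_compose: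
  assumes W: "partials_on A C W p q"
    and g: "\<And>x. x \<in> B \<Longrightarrow> (g has_real_derivative g' x) (at x within B)" "continuous_on B g'"
    and z: "\<And>x. x \<in> B \<Longrightarrow> (z has_real_derivative z' x) (at x within B)" "continuous_on B z'"
    and zC: "z ` B \<subseteq> C"
  shows "partials_on A B (\<lambda>t x. g x * W t (z x)) (\<lambda>t x. g x * p t (z x))
           (\<lambda>t x. g' x * W t (z x) + g x * z' x * q t (z x))"
proof -
  have cg: "continuous_on B g" and cz: "continuous_on B z"
    using g z by (auto intro: DERIV_continuous_on)
  have fs: "continuous_on (A \<times> B) (\<lambda>s. h (snd s))" if "continuous_on B h" for h :: "real \<Rightarrow> real"
    by (rule continuous_on_compose2[OF that]) (auto intro: continuous_intros)
  have comp: "continuous_on (A \<times> B) (\<lambda>s. v (fst s) (z (snd s)))"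
    if "continuous_on (A \<times> C) (\<lambda>(t, x). v t x)" for v :: "real \<Rightarrow> real \<Rightarrow> real"
    by (rule continuous_on_compose_pair[OF that]) (use zC fs[OF cz] in \<open>auto intro: continuous_intros\<close>)
  show ?thesis
    unfolding partials_on_def case_prod_unfold
  proof (intro conjI ballI)
    fix t x assume tx: "t \<in> A" "x \<in> B"
    then have zx: "z x \<in> C" using zC by auto
    show "((\<lambda>s. g x * W s (z x)) has_real_derivative g x * p t (z x)) (at t within A)"
      by (intro DERIV_cmult partials_onD(1)[OF W tx(1) zx])
    have "((\<lambda>y. W t (z y)) has_real_derivative q t (z x) * z' x) (at x within B)"
      using DERIV_image_chain[of "W t" "q t (z x)" z x B "z' x"]
        DERIV_subset[OF partials_onD(2)[OF W tx(1) zx] zC] z(1)[OF tx(2)]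
      by (simp add: o_def)
    then show "((\<lambda>y. g y * W t (z y)) has_real_derivative g' x * W t (z x) + g x * z' x * q t (z x)) (at x within B)"
      by (auto intro!: derivative_eq_intros g(1) tx)
  qed (intro continuous_intros fs comp cg cz g z partials_onD[OF W])+
qed

text \<open>
  Both partial derivatives vanish where \<open>w\<close> vanishes on an open strip, so the extension
  can be iterated: it applies to \<open>p\<close> and \<open>q\<close> in turn and yields \<open>C\<^sup>2\<close> regularity.
\<close>

lemma partials_on_extend_0:
  fixes T l h l' h' :: real
  assumes w: "partials_on {0..T} {l<..<h} w p q"
    and T: "T > 0" and lh: "l < l'" "h' < h"
    and w0: "\<And>t x. t \<in> {0..T} \<Longrightarrow> l < x \<Longrightarrow> x < h \<Longrightarrow> x < l' \<or> h' < x \<Longrightarrow> w t x = 0"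
  defines "ext \<equiv> \<lambda>(v::real\<Rightarrow>real\<Rightarrow>real) t x. if l < x \<and> x < h then v t x else 0"
  shows "partials_on {0..T} UNIV (ext w) (ext p) (ext q)"
    and "\<And>t x. t \<in> {0..T} \<Longrightarrow> l < x \<Longrightarrow> x < h \<Longrightarrow> x < l' \<or> h' < x \<Longrightarrow> p t x = 0"
    and "\<And>t x. t \<in> {0..T} \<Longrightarrow> l < x \<Longrightarrow> x < h \<Longrightarrow> x < l' \<or> h' < x \<Longrightarrow> q t x = 0"
proof -
  let ?W = "{..<l'} \<union> {h'<..}"
  have W: "open ?W" "{l<..<h} \<union> ?W = UNIV" using lh by auto
  show p0: "p t x = 0" if "t \<in> {0..T}" "l < x" "x < h" "x < l' \<or> h' < x" for t x
  proof -
    have x: "x \<in> {l<..<h}" using that by auto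
    have "((\<lambda>s. 0) has_real_derivative p t x) (at t within {0..T})"
      by (rule DERIV_cong_on[OF that(1) _ partials_onD(1)[OF w that(1) x]]) (use w0 that in auto)
    then have d: "((\<lambda>s. 0::real) has_vector_derivative p t x) (at t within {0..T})"
      by (simp only: has_real_derivative_iff_has_vector_derivative)
    have nt: "at t within {0..T} \<noteq> bot"
      using T that(1) by (simp add: trivial_limit_within islimpt_Icc)
    show ?thesis
      by (rule vector_derivative_unique_within[OF nt d has_vector_derivative_const])
  qed
  show q0: "q t x = 0" if "t \<in> {0..T}" "l < x" "x < h" "x < l' \<or> h' < x" for t x
  proof -
    have x: "x \<in> {l<..<h}" using that by auto
    have at: "at x within {l<..<h} = at x" by (rule at_within_open) (use x in auto)
    have "(w t has_real_derivative q t x) (at x)"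
      using partials_onD(2)[OF w that(1) x] unfolding at .
    moreover have "open ({l<..<h} \<inter> ?W)" using W(1) by (intro open_Int) auto
    ultimately have "((\<lambda>s. 0) has_real_derivative q t x) (at x)"
      by (rule has_field_derivative_transform_within_open) (use that w0 in auto)
    then show ?thesis using DERIV_unique DERIV_const by blast
  qed
  have ext_cont: "continuous_on ({0..T} \<times> UNIV) (\<lambda>(t, x). ext v t x)"
    if c: "continuous_on ({0..T} \<times> {l<..<h}) (\<lambda>(t, x). v t x)"
      and v0: "\<And>t x. t \<in> {0..T} \<Longrightarrow> l < x \<Longrightarrow> x < h \<Longrightarrow> x < l' \<or> h' < x \<Longrightarrow> v t x = 0" for v
  proof -
    let ?S = "{0..T} \<times> {l<..<h}" and ?R = "{0..T} \<times> ?W"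
    have un: "{0..T} \<times> UNIV = ?S \<union> ?R" using W(2) by blast
    have op: "openin (top_of_set ({0..T} \<times> (UNIV::real set))) ({0..T} \<times> V)" if "open V" for V :: "real set"
      unfolding openin_open using that by (intro exI[of _ "UNIV \<times> V"]) (auto intro: open_Times)
    have 1: "continuous_on ?S (\<lambda>(t, x). ext v t x)"
      by (rule continuous_on_eq[OF c]) (auto simp: ext_def)
    have 2: "continuous_on ?R (\<lambda>(t, x). ext v t x)"
      by (rule continuous_on_eq[OF continuous_on_const[of _ 0]]) (use v0 in \<open>auto simp: ext_def\<close>)
    show ?thesis
      unfolding un
      by (rule continuous_on_Un_local_open[OF _ _ 1 2]; fold un; intro op) (use W in auto)
  qed
  show "partials_on {0..T} UNIV (ext w) (ext p) (ext q)"
    unfolding partials_on_def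
  proof (intro conjI ballI)
    fix t x assume t: "t \<in> {0..T}"
    show "((\<lambda>s. ext w s x) has_real_derivative ext p t x) (at t within {0..T})"
      using partials_onD(1)[OF w t, of x] by (auto simp: ext_def)
    show "(ext w t has_real_derivative ext q t x) (at x)"
    proof (cases "x \<in> {l<..<h}")
      case True
      then have at: "at x within {l<..<h} = at x" by (intro at_within_open) auto
      have "(w t has_real_derivative q t x) (at x)"
        using partials_onD(2)[OF w t True] unfolding at .
      then have "(ext w t has_real_derivative q t x) (at x)"
        by (rule has_field_derivative_transform_within_open[of _ _ _ "{l<..<h}"])
          (use True in \<open>auto simp: ext_def\<close>)
      then show ?thesis using True by (simp add: ext_def)
    next
      case False
      have "((\<lambda>_. 0) has_real_derivative 0) (at x)" by simp
      then have "(ext w t has_real_derivative 0) (at x)"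
        by (rule has_field_derivative_transform_within_open[OF _ W(1)])
          (use False lh w0 t in \<open>auto simp: ext_def\<close>)
      then show ?thesis using False by (auto simp: ext_def)
    qed
  qed (intro ext_cont partials_onD[OF w] w0 p0 q0; assumption)+
qed

text \<open>
  The chain rule for the function of two variables \<open>(p, y) \<mapsto> integral {a..y} (k p)\<close>, whose partial
  derivatives are given by the Leibniz rule and the fundamental theorem of calculus.
\<close>

lemma DERIV_moving_integral:
  fixes k k' :: "real \<Rightarrow> real \<Rightarrow> real"
  assumes dk: "\<And>p y. p \<in> S \<Longrightarrow> y \<in> {a..b} \<Longrightarrow> ((\<lambda>p. k p y) has_real_derivative k' p y) (at p within S)"
    and ck: "continuous_on (S \<times> {a..b}) (\<lambda>(p, y). k p y)"
    and ck': "continuous_on (S \<times> {a..b}) (\<lambda>(p, y). k' p y)"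
    and p0: "p0 \<in> S" and S: "convex S"
    and \<beta>: "(\<beta> has_real_derivative \<beta>') (at p0 within S)" "\<And>p. p \<in> S \<Longrightarrow> a < \<beta> p \<and> \<beta> p < b"
  shows "((\<lambda>p. integral {a..\<beta> p} (k p)) has_real_derivative
           integral {a..\<beta> p0} (k' p0) + k p0 (\<beta> p0) * \<beta>') (at p0 within S)"
proof -
  let ?Y = "{a<..<b}"
  have slice: "continuous_on {a..b} (k p)" if "p \<in> S" for p
    by (rule continuous_on_compose_pair[OF ck continuous_on_const[of _ p] continuous_on_id])
      (use that in auto)
  have b0: "a < \<beta> p0" "\<beta> p0 < b" using \<beta>(2)[OF p0] by auto
  have fx: "((\<lambda>p. integral {a..\<beta> p0} (k p)) has_real_derivative integral {a..\<beta> p0} (k' p0)) (at p0 within S)"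
    using b0
    by (intro leibniz_rule_field_derivative[of S a "\<beta> p0" k k' p0, unfolded cbox_interval] p0 S dk
        integrable_continuous_real continuous_on_subset[OF slice] continuous_on_subset[OF ck']) auto
  have fy: "((\<lambda>y. integral {a..y} (k p)) has_derivative blinfun_apply (blinfun_mult_right (k p y))) (at y within ?Y)"
    if "p \<in> S" "y \<in> ?Y" for p y
  proof -
    have "((\<lambda>y. integral {a..y} (k p)) has_real_derivative k p y) (at y within ?Y)"
      by (rule DERIV_subset[OF integral_has_real_derivative[OF slice[OF that(1)]]]) (use that in auto)
    then show ?thesis
      unfolding has_field_derivative_def by simp
  qed
  have "continuous_on (S \<times> ?Y) (\<lambda>(p, y). blinfun_mult_right (k p y))"
    unfolding case_prod_unfold
    by (intro bounded_linear.continuous_on[OF bounded_linear_blinfun_mult_right]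
        continuous_on_subset[OF ck[unfolded case_prod_unfold]]) auto
  then have cont: "continuous (at (p0, \<beta> p0) within S \<times> ?Y) (\<lambda>(p, y). blinfun_mult_right (k p y))"
    using p0 b0 by (auto simp: continuous_on_eq_continuous_within)
  have F: "((\<lambda>(p, y). integral {a..y} (k p)) has_derivative
      (\<lambda>(h, j). integral {a..\<beta> p0} (k' p0) * h + blinfun_mult_right (k p0 (\<beta> p0)) j))
      (at (p0, \<beta> p0) within S \<times> ?Y)"
    by (rule has_derivative_partialsI[OF fx[unfolded has_field_derivative_def] fy cont]) (use b0 in auto)
  have pair: "((\<lambda>p. (p, \<beta> p)) has_derivative (\<lambda>h. (h, \<beta>' * h))) (at p0 within S)"
    by (intro has_derivative_Pair has_derivative_ident \<beta>(1)[unfolded has_field_derivative_def])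
  have "(\<lambda>p. (p, \<beta> p)) ` S \<subseteq> S \<times> ?Y" using \<beta>(2) by auto
  from diff_chain_within[OF pair has_derivative_subset[OF F this]]
  have "((\<lambda>p. integral {a..\<beta> p} (k p)) has_derivative
      (\<lambda>h. integral {a..\<beta> p0} (k' p0) * h + k p0 (\<beta> p0) * (\<beta>' * h))) (at p0 within S)"
    by (simp add: o_def)
  then show ?thesis
    unfolding has_field_derivative_def by (rule has_derivative_eq_rhs) (auto simp: algebra_simps)
qed

text \<open>
  The substitution \<open>y = a + (\<beta> p - a) * s\<close> moves the variable end point into the integrand.
\<close>

lemma continuous_on_moving_integral:
  fixes k :: "'a::topological_space \<Rightarrow> real \<Rightarrow> real"
  assumes ck: "continuous_on (U \<times> {a..b}) (\<lambda>(p, y). k p y)"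
    and \<beta>: "continuous_on U \<beta>" "\<And>p. p \<in> U \<Longrightarrow> \<beta> p \<in> {a..b}"
  shows "continuous_on U (\<lambda>p. integral {a..\<beta> p} (k p))"
proof -
  let ?g = "\<lambda>p s. a + (\<beta> p - a) * s"
  have g_in: "?g p s \<in> {a..b}" if "p \<in> U" "s \<in> {0..1}" for p s
  proof -
    have "0 \<le> (\<beta> p - a) * s" "(\<beta> p - a) * s \<le> (\<beta> p - a) * 1"
      using \<beta>(2)[OF that(1)] that(2) mult_left_mono[of s 1 "\<beta> p - a"] by auto
    then show ?thesis using \<beta>(2)[OF that(1)] by auto
  qed
  have eq: "integral {0..1} (\<lambda>s. (\<beta> p - a) * k p (?g p s)) = integral {a..\<beta> p} (k p)" if "p \<in> U" for p
  proof -
    have "continuous_on {a..b} (\<lambda>y. (p, y))"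
      by (intro continuous_on_Pair continuous_on_const continuous_on_id)
    from continuous_on_compose2[OF ck this] that have c: "continuous_on {a..b} (k p)"
      by auto
    have "((\<lambda>s. (\<beta> p - a) *\<^sub>R k p (?g p s)) has_integral integral {?g p 0..?g p 1} (k p)) {0..1}"
      by (rule has_integral_substitution[OF _ _ _ c])
        (use g_in[OF that] \<beta>(2)[OF that] in \<open>auto intro!: derivative_eq_intros\<close>)
    from integral_unique[OF this] show ?thesis by simp
  qed
  have "continuous_on (U \<times> cbox 0 1) (\<lambda>(p, s). (\<beta> p - a) * k p (?g p s))"
    unfolding case_prod_unfold
  proof (intro continuous_intros)
    show b: "continuous_on (U \<times> cbox 0 (1::real)) (\<lambda>x. \<beta> (fst x))"
      by (rule continuous_on_compose2[OF \<beta>(1)]) (auto intro: continuous_intros)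
    have "continuous_on (U \<times> cbox 0 (1::real)) (\<lambda>x. (fst x, ?g (fst x) (snd x)))"
      by (intro continuous_intros b)
    then show "continuous_on (U \<times> cbox 0 (1::real)) (\<lambda>x. k (fst x) (?g (fst x) (snd x)))"
      using continuous_on_compose2[OF ck, of _ "\<lambda>x. (fst x, ?g (fst x) (snd x))"] g_in by fastforce
  qed
  from integral_continuous_on_param[OF this]
  have "continuous_on U (\<lambda>p. integral {0..1} (\<lambda>s. (\<beta> p - a) * k p (?g p s)))" by simp
  then show ?thesis by (rule continuous_on_eq) (use eq in auto)
qed

text \<open>
  Differentiating \<open>u t y = u t a + integral {a..y} (q t)\<close> in \<open>t\<close> under
  the integral expresses \<open>p t y - p t a\<close> as the integral of \<open>qt t\<close>, and then \<open>y\<close> is differentiated.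
\<close>

lemma partials_on_mixed:
  fixes a b T :: real
  assumes T: "T > 0" and ab: "a < b"
    and u: "partials_on {0..T} {a..b} u p q"
    and p: "partials_on {0..T} {a..b} p pt px"
    and q: "partials_on {0..T} {a..b} q qt qx"
    and t: "t \<in> {0..T}" and x: "x \<in> {a..b}"
  shows "qt t x = px t x"
proof -
  have slice: "continuous_on {a..b} (v s)" if "continuous_on ({0..T} \<times> {a..b}) (\<lambda>(t, x). v t x)" "s \<in> {0..T}"
    for v :: "real \<Rightarrow> real \<Rightarrow> real" and s
    by (rule continuous_on_compose_pair[OF that(1) continuous_on_const[of _ s] continuous_on_id])
      (use that in auto)
  have nt: "at t within {0..T} \<noteq> bot"
    using T t by (simp add: trivial_limit_within islimpt_Icc)
  have nx: "at x within {a..b} \<noteq> bot"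
    using ab x by (simp add: trivial_limit_within islimpt_Icc)
  have int: "p t y = p t a + integral {a..y} (qt t)" if y: "y \<in> {a..b}" for y
  proof -
    have ftc: "integral {a..y} (q s) = u s y - u s a" if s: "s \<in> {0..T}" for s
      by (intro integral_unique fundamental_theorem_of_calculus)
        (use y in \<open>auto simp: has_real_derivative_iff_has_vector_derivative[symmetric]
          intro!: DERIV_subset[OF partials_onD(2)[OF u s]]\<close>)
    have "((\<lambda>s. integral {a..y} (q s)) has_real_derivative integral {a..y} (qt t)) (at t within {0..T})"
      using y t
      by (intro leibniz_rule_field_derivative[of "{0..T}" a y q qt t, unfolded cbox_interval]
          partials_onD(1)[OF q] integrable_continuous_real
          continuous_on_subset[OF slice[OF partials_onD(3)[OF q]]]
          continuous_on_subset[OF partials_onD(4)[OF q]]) auto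
    then have "((\<lambda>s. u s y - u s a) has_real_derivative integral {a..y} (qt t)) (at t within {0..T})"
      by (rule DERIV_cong_on[OF t, rotated]) (simp add: ftc)
    moreover have "((\<lambda>s. u s y - u s a) has_real_derivative p t y - p t a) (at t within {0..T})"
      using y ab by (intro DERIV_diff partials_onD(1)[OF u t]) auto
    ultimately have "integral {a..y} (qt t) = p t y - p t a"
      unfolding has_real_derivative_iff_has_vector_derivative
      by (rule vector_derivative_unique_within[OF nt])
    then show ?thesis by simp
  qed
  have "((\<lambda>y. p t a + integral {a..y} (qt t)) has_real_derivative 0 + qt t x) (at x within {a..b})"
    by (intro DERIV_add DERIV_const integral_has_real_derivative slice partials_onD(4)[OF q] t x)
  then have "(p t has_real_derivative qt t x) (at x within {a..b})"
    using DERIV_cong_on[OF x int] by simp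
  with partials_onD(2)[OF p t x] show ?thesis
    unfolding has_real_derivative_iff_has_vector_derivative
    using vector_derivative_unique_within[OF nx] by blast
qed

section \<open>Finite speed of propagation and uniqueness\<close>

text \<open>
  A weight that is \<open>C\<^sup>1\<close>, nonincreasing, and positive exactly below \<open>Z\<close>. Applied to \<open>t + \<zeta> x\<close> it
  localises the energy to a cone, while the domain of integration stays fixed in time.
\<close>

definition cutoff :: "real \<Rightarrow> real \<Rightarrow> real" where
  "cutoff Z s = (max 0 (Z - s))\<^sup>2"

lemma DERIV_cutoff: "(cutoff Z has_real_derivative (- 2 * max 0 (Z - s))) (at s)"
proof -
  consider "s < Z" | "s > Z" | "s = Z" by linarith
  then show ?thesis
  proof cases
    case 1
    have "((\<lambda>s. (Z - s)\<^sup>2) has_real_derivative (- 2 * (Z - s))) (at s)"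
      by (auto intro!: derivative_eq_intros)
    then have "(cutoff Z has_real_derivative (- 2 * (Z - s))) (at s)"
      by (rule has_field_derivative_transform_within_open[of _ _ _ "{..<Z}"])
        (use 1 in \<open>auto simp: cutoff_def\<close>)
    then show ?thesis using 1 by simp
  next
    case 2
    have "((\<lambda>s. 0) has_real_derivative 0) (at s)" by simp
    then have "(cutoff Z has_real_derivative 0) (at s)"
      by (rule has_field_derivative_transform_within_open[of _ _ _ "{Z<..}"])
        (use 2 in \<open>auto simp: cutoff_def\<close>)
    then show ?thesis using 2 by simp
  next
    case 3
    have "((\<lambda>y. (cutoff Z y - cutoff Z Z) / (y - Z)) \<longlongrightarrow> 0) (at Z)"
    proof (rule Lim_null_comparison)
      show "\<forall>\<^sub>F y in at Z. norm ((cutoff Z y - cutoff Z Z) / (y - Z)) \<le> \<bar>y - Z\<bar>"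
      proof (rule always_eventually, rule allI)
        fix y
        have "cutoff Z y \<le> \<bar>y - Z\<bar> * \<bar>y - Z\<bar>"
          unfolding cutoff_def power2_eq_square by (intro mult_mono) auto
        then show "norm ((cutoff Z y - cutoff Z Z) / (y - Z)) \<le> \<bar>y - Z\<bar>"
          by (cases "y = Z") (auto simp: divide_le_eq, simp add: cutoff_def)
      qed
      show "((\<lambda>y. \<bar>y - Z\<bar>) \<longlongrightarrow> 0) (at Z)"
        by (rule tendsto_eq_intros | simp)+
    qed
    then show ?thesis using 3 by (simp add: has_field_derivative_iff)
  qed
qed

text \<open>
  The energy \<open>E\<close>, weighted by \<open>cutoff\<close>, is nonincreasing: the time derivative of its density is the
  \<open>x\<close>-derivative of \<open>P = 2 * cutoff * x powr \<theta> * p * q\<close> minus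
  \<open>R = 2 * max 0 (Z - (t + \<zeta> x)) * (p + x powr (\<theta> / 2) * q)\<^sup>2\<close>. That \<open>R\<close> is a perfect square reflects that
  the edge of the cone is characteristic. The function \<open>P\<close> vanishes at \<open>x = 1\<close> by the boundary
  condition on \<open>p\<close> and at \<open>x = a\<close> by the weight. So \<open>E\<close> stays zero, and with it \<open>p\<close>.
\<close>

lemma wave_vanishes_in_cone:
  fixes T \<theta> a Z :: real
  assumes a: "0 < a" "a < 1"
    and p: "partials_on {0..T} {a..1} p pt px"
    and q: "partials_on {0..T} {a..1} q px qx"
    and pde: "\<And>t x. t \<in> {0<..<T} \<Longrightarrow> x \<in> {a<..<1} \<Longrightarrow>
           pt t x = x powr \<theta> * qx t x + \<theta> * x powr (\<theta> - 1) * q t x"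
    and bc: "\<And>t. t \<in> {0<..<T} \<Longrightarrow> p t 1 = 0"
    and ic: "\<And>x. x \<in> {a<..<1} \<Longrightarrow> p 0 x = 0 \<and> q 0 x = 0"
    and \<zeta>: "\<And>x. x \<in> {a..1} \<Longrightarrow> (\<zeta> has_real_derivative - (x powr (- \<theta> / 2))) (at x)"
    and Z: "Z \<le> \<zeta> a"
    and tx: "t \<in> {0..T}" "x \<in> {a..1}" "t + \<zeta> x < Z"
  shows "p t x = 0"
proof -
  define F where "F = (\<lambda>t x. cutoff Z (t + \<zeta> x) * ((p t x)\<^sup>2 + x powr \<theta> * (q t x)\<^sup>2))"
  define D where "D = (\<lambda>t x. (- 2 * max 0 (Z - (t + \<zeta> x))) * ((p t x)\<^sup>2 + x powr \<theta> * (q t x)\<^sup>2)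
      + cutoff Z (t + \<zeta> x) * (2 * p t x * pt t x + x powr \<theta> * (2 * q t x * px t x)))"
  define E where "E = (\<lambda>t. integral {a..1} (F t))"
  let ?S = "{0..T} \<times> {a..1}"
  have c\<zeta>: "continuous_on {a..1} \<zeta>"
    by (rule DERIV_continuous_on) (use \<zeta> DERIV_subset in blast)
  have c\<zeta>': "continuous_on ?S (\<lambda>s. \<zeta> (snd s))"
    by (rule continuous_on_compose2[OF c\<zeta>]) (auto intro: continuous_intros)
  have c_pow: "continuous_on ?S (\<lambda>s. snd s powr r)" for r
    using a by (auto intro!: continuous_intros)
  have c_cut: "continuous_on UNIV (cutoff Z)"
    unfolding cutoff_def by (intro continuous_intros)
  have c_cut': "continuous_on ?S (\<lambda>s. cutoff Z (fst s + \<zeta> (snd s)))"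
    by (rule continuous_on_compose2[OF c_cut]) (auto intro!: continuous_intros c\<zeta>')
  note conts = partials_onD(3-5)[OF p, unfolded case_prod_unfold]
    partials_onD(3-5)[OF q, unfolded case_prod_unfold]
  have cF: "continuous_on ?S (\<lambda>(t, x). F t x)"
    unfolding F_def case_prod_unfold by (intro continuous_intros conts c_cut' c_pow)
  have cD: "continuous_on ?S (\<lambda>(t, x). D t x)"
    unfolding D_def case_prod_unfold by (intro continuous_intros conts c_cut' c_pow c\<zeta>')
  have slice: "continuous_on {a..1} (v s)" if "continuous_on ?S (\<lambda>(t, x). v t x)" "s \<in> {0..T}"
    for v :: "real \<Rightarrow> real \<Rightarrow> real" and s
    by (rule continuous_on_compose_pair[OF that(1) continuous_on_const[of _ s] continuous_on_id])
      (use that in auto)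
  have F_nonneg: "F s y \<ge> 0" for s y
    by (simp add: F_def cutoff_def)
  have cE: "continuous_on {0..T} E"
    unfolding E_def using integral_continuous_on_param[of "{0..T}" a 1 F] cF by simp
  have dE: "(E has_real_derivative integral {a..1} (D s)) (at s)" if s: "s \<in> {0<..<T}" for s
  proof -
    have "((\<lambda>t. integral {a..1} (F t)) has_real_derivative integral {a..1} (D s)) (at s within {0..T})"
    proof (rule leibniz_rule_field_derivative[of "{0..T}" a 1 F D s, unfolded cbox_interval])
      fix r y assume r: "r \<in> {0..T}" and y: "y \<in> {a..1}"
      have dc: "((\<lambda>t. cutoff Z (t + \<zeta> y)) has_real_derivative (- 2 * max 0 (Z - (r + \<zeta> y))) * 1) (at r within {0..T})"
        by (rule DERIV_chain2[OF DERIV_cutoff]) (auto intro!: derivative_eq_intros)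
      show "((\<lambda>t. F t y) has_real_derivative D r y) (at r within {0..T})"
        unfolding F_def
        by (rule derivative_eq_intros dc partials_onD(1)[OF p r y] partials_onD(1)[OF q r y] refl)+
          (simp add: D_def)
    qed (use s cD slice[OF cF] in \<open>auto intro!: integrable_continuous_real\<close>)
    moreover have "at s within {0..T} = at s" using s by (intro at_within_Icc_at) auto
    ultimately show ?thesis by (simp add: E_def)
  qed
  have D_nonpos: "integral {a..1} (D s) \<le> 0" if s: "s \<in> {0<..<T}" for s
  proof -
    have s': "s \<in> {0..T}" using s by auto
    define R where "R = (\<lambda>y. 2 * max 0 (Z - (s + \<zeta> y)) * (p s y + y powr (\<theta> / 2) * q s y)\<^sup>2)"
    define P where "P = (\<lambda>y. 2 * cutoff Z (s + \<zeta> y) * y powr \<theta> * p s y * q s y)"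
    have "((\<lambda>y. D s y + R y) has_integral P 1 - P a) {a..1}"
    proof (rule fundamental_theorem_of_calculus_interior)
      have "continuous_on {a..1} (\<lambda>y. cutoff Z (s + \<zeta> y))"
        by (rule continuous_on_compose2[OF c_cut]) (auto intro!: continuous_intros c\<zeta>)
      then show "continuous_on {a..1} P"
        unfolding P_def using a
        by (auto intro!: continuous_intros slice[OF partials_onD(3)[OF p] s'] slice[OF partials_onD(3)[OF q] s'])
      fix y assume y: "y \<in> {a<..<1}"
      then have y': "y \<in> {a..1}" and y0: "y > 0" using a by auto
      have at: "at y within {a..1} = at y" using y by (intro at_within_Icc_at) auto
      have dp: "(p s has_real_derivative px s y) (at y)" and dq: "(q s has_real_derivative qx s y) (at y)"
        using partials_onD(2)[OF p s' y'] partials_onD(2)[OF q s' y'] by (auto simp: at)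
      have "((\<lambda>y. cutoff Z (s + \<zeta> y)) has_real_derivative
          (- 2 * max 0 (Z - (s + \<zeta> y))) * (- (y powr (- \<theta> / 2)))) (at y)"
        by (rule DERIV_chain2[OF DERIV_cutoff]) (auto intro!: derivative_eq_intros \<zeta> y')
      then have "(P has_real_derivative
           2 * ((- 2 * max 0 (Z - (s + \<zeta> y))) * (- (y powr (- \<theta> / 2)))) * y powr \<theta> * p s y * q s y
         + 2 * cutoff Z (s + \<zeta> y) * (\<theta> * y powr (\<theta> - 1)) * p s y * q s y
         + 2 * cutoff Z (s + \<zeta> y) * y powr \<theta> * (px s y * q s y + p s y * qx s y)) (at y)"
        unfolding P_def using y0
        by (auto intro!: derivative_eq_intros dp dq simp: algebra_simps)
      also have "2 * ((- 2 * max 0 (Z - (s + \<zeta> y))) * (- (y powr (- \<theta> / 2)))) * y powr \<theta> * p s y * q s y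
         + 2 * cutoff Z (s + \<zeta> y) * (\<theta> * y powr (\<theta> - 1)) * p s y * q s y
         + 2 * cutoff Z (s + \<zeta> y) * y powr \<theta> * (px s y * q s y + p s y * qx s y) = D s y + R y"
      proof -
        have h: "y powr (- \<theta> / 2) * y powr \<theta> = y powr (\<theta> / 2)"
          using y0 by (simp add: powr_add[symmetric])
        have h2: "y powr \<theta> = (y powr (\<theta> / 2))\<^sup>2"
          using y0 by (simp add: power2_eq_square powr_add[symmetric])
        have "2 * ((- 2 * max 0 (Z - (s + \<zeta> y))) * (- (y powr (- \<theta> / 2)))) * y powr \<theta> * p s y * q s y
          = 4 * max 0 (Z - (s + \<zeta> y)) * (y powr (- \<theta> / 2) * y powr \<theta>) * p s y * q s y"
          by simp
        also have "\<dots> = 4 * max 0 (Z - (s + \<zeta> y)) * y powr (\<theta> / 2) * p s y * q s y"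
          by (simp only: h)
        finally have 1: "2 * ((- 2 * max 0 (Z - (s + \<zeta> y))) * (- (y powr (- \<theta> / 2)))) * y powr \<theta> * p s y * q s y
          = 4 * max 0 (Z - (s + \<zeta> y)) * y powr (\<theta> / 2) * p s y * q s y" .
        have 2: "R y = 2 * max 0 (Z - (s + \<zeta> y)) * ((p s y)\<^sup>2 + 2 * y powr (\<theta> / 2) * p s y * q s y
            + y powr \<theta> * (q s y)\<^sup>2)"
          unfolding R_def h2 by (simp add: power2_eq_square algebra_simps)
        show ?thesis
          unfolding 1 2 D_def pde[OF s y] by (simp add: algebra_simps)
      qed
      finally show "(P has_vector_derivative D s y + R y) (at y)"
        by (simp add: has_real_derivative_iff_has_vector_derivative)
    qed (use a in simp)
    moreover have "P 1 = 0" using bc[OF s] by (simp add: P_def)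
    moreover have "P a = 0" using Z s by (simp add: P_def cutoff_def)
    ultimately have DR: "((\<lambda>y. D s y + R y) has_integral 0) {a..1}" by simp
    have D: "(D s has_integral integral {a..1} (D s)) {a..1}"
      by (intro integrable_integral integrable_continuous_real slice[OF cD s'])
    have "(R has_integral (0 - integral {a..1} (D s))) {a..1}"
      using has_integral_diff[OF DR D] by simp
    then have "0 \<le> 0 - integral {a..1} (D s)"
      by (rule has_integral_nonneg) (simp add: R_def)
    then show ?thesis by simp
  qed
  have "E 0 = integral {a<..<1} (F 0)"
    by (simp add: E_def integral_open_interval_real)
  also have "\<dots> = integral {a<..<1} (\<lambda>_. 0)"
    by (rule integral_cong) (simp add: F_def ic)
  finally have E0: "E 0 = 0" by simp
  have "E t \<le> E 0"
  proof (rule DERIV_nonpos_imp_decreasing_open[of 0 t E])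
    show "\<exists>y. (E has_real_derivative y) (at s) \<and> y \<le> 0" if "0 < s" "s < t" for s
      using dE[of s] D_nonpos[of s] that tx by (intro exI[of _ "integral {a..1} (D s)"]) auto
    show "continuous_on {0..t} E"
      by (rule continuous_on_subset[OF cE]) (use tx in auto)
  qed (use tx in auto)
  moreover have "E t \<ge> 0"
    unfolding E_def by (intro integral_nonneg integrable_continuous_real slice[OF cF] tx F_nonneg)
  ultimately have "integral {a..1} (F t) = 0" using E0 by (simp add: E_def)
  then have "F t x = 0"
    using integral_eq_0_iff[OF slice[OF cF tx(1)] a(2) F_nonneg] tx(2) by simp
  moreover have "cutoff Z (t + \<zeta> x) > 0" using tx(3) by (simp add: cutoff_def)
  ultimately have "(p t x)\<^sup>2 + x powr \<theta> * (q t x)\<^sup>2 = 0" by (simp add: F_def)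
  then show ?thesis by (simp add: add_nonneg_eq_0_iff)
qed

text \<open>
  A cone containing \<open>[0,T] \<times> {x}\<close> can be closed off at some \<open>a > 0\<close>, so \<open>p\<close> vanishes on all
  of \<open>[0,T] \<times> {x}\<close> and \<open>e\<close> keeps its initial value there. At the corner point \<open>x = 1\<close> the value comes
  from the boundary condition instead, the initial condition being known for \<open>x < 1\<close> only.
\<close>

lemma wave_unique:
  fixes T \<theta> :: real
  assumes T: "T > 0" and \<theta>: "\<theta> > 2"
    and e: "partials_on {0..T} {0<..1} e p q"
    and p: "partials_on {0..T} {0<..1} p pt px"
    and q: "partials_on {0..T} {0<..1} q qt qx"
    and pde: "\<And>t x. t \<in> {0<..<T} \<Longrightarrow> x \<in> {0<..<1} \<Longrightarrow>
           pt t x = x powr \<theta> * qx t x + \<theta> * x powr (\<theta> - 1) * q t x"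
    and bc: "\<And>t. t \<in> {0<..<T} \<Longrightarrow> e t 1 = 0"
    and ic: "\<And>x. x \<in> {0<..<1} \<Longrightarrow> e 0 x = 0 \<and> p 0 x = 0"
    and tx: "t \<in> {0..T}" "x \<in> {0<..1}"
  shows "e t x = 0"
proof -
  define \<kappa> where "\<kappa> = \<theta> / 2 - 1"
  have \<kappa>: "\<kappa> > 0" using \<theta> by (simp add: \<kappa>_def)
  define \<zeta> where "\<zeta> = (\<lambda>x::real. x powr (- \<kappa>) / \<kappa>)"
  have d\<zeta>: "(\<zeta> has_real_derivative - (y powr (- \<theta> / 2))) (at y)" if "y > 0" for y
  proof -
    have "(\<zeta> has_real_derivative (- \<kappa> * y powr (- \<kappa> - 1)) / \<kappa>) (at y)"
      unfolding \<zeta>_def using that by (auto intro!: derivative_eq_intros)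
    moreover have "- \<kappa> - 1 = - \<theta> / 2" by (simp add: \<kappa>_def)
    ultimately show ?thesis using \<kappa> by simp
  qed
  define Z where "Z = T + \<zeta> x + 1"
  have \<zeta>x: "\<zeta> x \<ge> 0" using \<kappa> by (simp add: \<zeta>_def)
  then have Zpos: "Z > 0" using T by (simp add: Z_def)
  define a where "a = (\<kappa> * Z) powr (- (1 / \<kappa>))"
  have a0: "a > 0" using Zpos \<kappa> by (simp add: a_def)
  have \<zeta>a: "\<zeta> a = Z"
    using Zpos \<kappa> by (simp add: \<zeta>_def a_def powr_powr)
  have ax: "a < x"
  proof (rule ccontr)
    assume "\<not> a < x"
    then have "\<zeta> a \<le> \<zeta> x"
      using tx \<kappa> unfolding \<zeta>_def by (intro divide_right_mono powr_mono2') auto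
    then show False using \<zeta>a T by (simp add: Z_def)
  qed
  have a1: "a < 1" using ax tx by simp
  have sub: "{a..1} \<subseteq> {0<..1}" using a0 by auto
  note restrict = partials_on_mono[OF _ order_refl sub]
  have mixed: "qt s y = px s y" if "s \<in> {0..T}" "y \<in> {a..1}" for s y
    using partials_on_mixed[OF T a1 restrict[OF e] restrict[OF p] restrict[OF q] that] .
  have q': "partials_on {0..T} {a..1} q px qx"
    by (rule partials_on_cong[OF restrict[OF q]]) (use mixed in auto)
  have p1: "p s 1 = 0" if s: "s \<in> {0<..<T}" for s
  proof -
    have "((\<lambda>s. e s 1) has_real_derivative p s 1) (at s within {0..T})"
      using s by (intro partials_onD(1)[OF e]) auto
    moreover have "at s within {0..T} = at s" using s by (intro at_within_Icc_at) auto
    ultimately have "((\<lambda>s. e s 1) has_real_derivative p s 1) (at s)" by simp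
    then have "((\<lambda>s. 0) has_real_derivative p s 1) (at s)"
      by (rule has_field_derivative_transform_within_open[of _ _ _ "{0<..<T}"]) (use s bc in auto)
    then show ?thesis using DERIV_unique DERIV_const by blast
  qed
  have q0: "q 0 y = 0" if y: "y \<in> {0<..<1}" for y
  proof -
    have "(e 0 has_real_derivative q 0 y) (at y within {0<..<1})"
      using y T by (intro DERIV_subset[OF partials_onD(2)[OF e]]) auto
    moreover have "at y within {0<..<1} = at y" by (rule at_within_open[OF y]) simp
    ultimately have "(e 0 has_real_derivative q 0 y) (at y)" by (simp only:)
    then have "((\<lambda>s. 0) has_real_derivative q 0 y) (at y)"
      by (rule has_field_derivative_transform_within_open[of _ _ _ "{0<..<1}"]) (use y ic in auto)
    then show ?thesis using DERIV_unique DERIV_const by blast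
  qed
  have p0: "p s x = 0" if s: "s \<in> {0..T}" for s
  proof (rule wave_vanishes_in_cone[OF a0 a1 restrict[OF p] q', where \<theta>=\<theta> and \<zeta>=\<zeta> and Z=Z])
    show "pt t x = x powr \<theta> * qx t x + \<theta> * x powr (\<theta> - 1) * q t x"
      if "t \<in> {0<..<T}" "x \<in> {a<..<1}" for t x
      by (rule pde) (use that a0 in auto)
    show "p 0 y = 0 \<and> q 0 y = 0" if "y \<in> {a<..<1}" for y
      using that a0 ic q0 by auto
    show "(\<zeta> has_real_derivative - (y powr (- \<theta> / 2))) (at y)" if "y \<in> {a..1}" for y
      by (rule d\<zeta>) (use that a0 in auto)
    show "s + \<zeta> x < Z" using s by (simp add: Z_def)
  qed (use p1 \<zeta>a s tx ax in auto)
  have "\<exists>c. \<forall>s\<in>{0..T}. e s x = c"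
    by (rule has_field_derivative_zero_constant)
      (use partials_onD(1)[OF e _ tx(2)] p0 in \<open>auto simp del: atLeastAtMost_iff\<close>)
  then obtain c where c: "\<And>s. s \<in> {0..T} \<Longrightarrow> e s x = c" by blast
  show ?thesis
  proof (cases "x = 1")
    case True
    then show ?thesis using c[OF tx(1)] c[of "T / 2"] bc[of "T / 2"] T by auto
  next
    case False
    then show ?thesis using c[OF tx(1)] c[of 0] ic[of x] T tx by auto
  qed
qed

section \<open>The hypergeometric profile of the Riemann function\<close>

text \<open>
  The Taylor coefficients of the hypergeometric function with \<open>a + b = 1\<close>, \<open>a b = - \<mu>\<close>,
  \<open>c = 1\<close>, which is a Legendre function in the variable \<open>1 - 2 s\<close>.
\<close>

primrec riemann_coeff :: "real \<Rightarrow> nat \<Rightarrow> real" where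
  "riemann_coeff \<mu> 0 = 1"
| "riemann_coeff \<mu> (Suc n) = (n * (n + 1) - \<mu>) / (n + 1)\<^sup>2 * riemann_coeff \<mu> n"

lemma riemann_coeff_bound: "\<bar>riemann_coeff \<mu> n\<bar> \<le> (1 + \<bar>\<mu>\<bar>) ^ n"
proof (induction n)
  case (Suc n)
  have "\<bar>real n * (real n + 1) - \<mu>\<bar> \<le> (1 + \<bar>\<mu>\<bar>) * (real n + 1)\<^sup>2"
  proof -
    have "\<bar>real n * (real n + 1) - \<mu>\<bar> \<le> real n * (real n + 1) + \<bar>\<mu>\<bar> * 1"
      using abs_triangle_ineq4[of "real n * (real n + 1)" \<mu>] by (simp add: abs_mult)
    also have "\<dots> \<le> (real n + 1)\<^sup>2 + \<bar>\<mu>\<bar> * (real n + 1)\<^sup>2"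
      by (intro add_mono mult_left_mono) (auto simp: power2_eq_square algebra_simps)
    finally show ?thesis by (simp add: algebra_simps)
  qed
  then have "\<bar>(real n * (real n + 1) - \<mu>) / (real n + 1)\<^sup>2\<bar> \<le> 1 + \<bar>\<mu>\<bar>"
    by (simp add: abs_divide divide_le_eq)
  then show ?case
    using mult_mono[OF _ Suc.IH, of "\<bar>(real n * (real n + 1) - \<mu>) / (real n + 1)\<^sup>2\<bar>" "1 + \<bar>\<mu>\<bar>"]
    by (simp add: abs_mult add.commute)
qed simp

lemma fps_conv_radius_ge_geometric:
  fixes F :: "real fps"
  assumes "\<And>n. \<bar>fps_nth F n\<bar> \<le> M ^ n" "M > 0"
  shows "fps_conv_radius F \<ge> ereal (1 / M)"
  unfolding fps_conv_radius_def
proof (rule conv_radius_geI_ex)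
  fix r :: real assume r: "0 < r" "ereal r < ereal (1 / M)"
  then have "norm (M * r) < 1" using assms(2) by (simp add: field_simps)
  then have "summable (\<lambda>n. (M * r) ^ n)" by (rule summable_geometric)
  then have "summable (\<lambda>n. fps_nth F n * r ^ n)"
    by (rule summable_comparison_test')
      (use assms r in \<open>auto simp: abs_mult power_mult_distrib power_abs intro!: mult_right_mono\<close>)
  then show "\<exists>z. norm z = r \<and> summable (\<lambda>n. fps_nth F n * z ^ n)"
    using r by (intro exI[of _ r]) auto
qed

text \<open>
  The equation for \<open>G\<close> is exactly what makes \<open>G\<close> of the Lorentz invariant solve the wave equation
  with potential \<open>\<mu> / z\<^sup>2\<close>, and \<open>G 0 = 1\<close> normalises it on the characteristics. The true radius of
  convergence is one for generic \<open>\<mu>\<close>; the cruder radius \<open>1 / (1 + \<bar>\<mu>\<bar>)\<close> comes from a geometric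
  bound on the coefficients and suffices because the support of the data can be moved outwards.
\<close>

lemma riemann_profile_exists:
  fixes \<mu> :: real
  defines "r \<equiv> 1 / (1 + \<bar>\<mu>\<bar>)"
  obtains G G1 G2 :: "real \<Rightarrow> real" where
    "\<And>s. \<bar>s\<bar> < r \<Longrightarrow> (G has_real_derivative G1 s) (at s)"
    "\<And>s. \<bar>s\<bar> < r \<Longrightarrow> (G1 has_real_derivative G2 s) (at s)"
    "continuous_on {-r<..<r} G2"
    "\<And>s. \<bar>s\<bar> < r \<Longrightarrow> s * (1 - s) * G2 s + (1 - 2 * s) * G1 s + \<mu> * G s = 0"
    "G 0 = 1"
proof -
  define F where "F = Abs_fps (riemann_coeff \<mu>)"
  define F1 where "F1 = fps_deriv F"
  define F2 where "F2 = fps_deriv F1"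
  have rad: "fps_conv_radius F \<ge> ereal r"
    unfolding r_def F_def by (rule fps_conv_radius_ge_geometric) (auto simp: riemann_coeff_bound)
  have rad1: "fps_conv_radius F1 \<ge> ereal r"
    unfolding F1_def using rad fps_conv_radius_deriv order_trans by blast
  have rad2: "fps_conv_radius F2 \<ge> ereal r"
    unfolding F2_def using rad1 fps_conv_radius_deriv order_trans by blast
  have in_rad: "ereal (norm s) < fps_conv_radius F" "ereal (norm s) < fps_conv_radius F1"
      "ereal (norm s) < fps_conv_radius F2" if "\<bar>s\<bar> < r" for s
    using that order.strict_trans2[OF _ rad] order.strict_trans2[OF _ rad1]
      order.strict_trans2[OF _ rad2] by auto
  let ?X = "fps_X :: real fps"
  have fps_ode: "?X * F2 - ?X * (?X * F2) + F1 - fps_const 2 * (?X * F1) + fps_const \<mu> * F = 0"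
  proof (rule fps_ext)
    fix n
    show "fps_nth (?X * F2 - ?X * (?X * F2) + F1 - fps_const 2 * (?X * F1) + fps_const \<mu> * F) n
        = fps_nth 0 n"
    proof (cases n)
      case 0
      then show ?thesis by (simp add: F1_def F2_def F_def)
    next
      case (Suc k)
      define c d where "c = riemann_coeff \<mu> (Suc k)" and "d = riemann_coeff \<mu> (Suc (Suc k))"
      have "d = (real (Suc k) * (real (Suc k) + 1) - \<mu>) / (real (Suc k) + 1)\<^sup>2 * c"
        unfolding c_def d_def by (rule riemann_coeff.simps(2))
      then have rec: "(real k + 2)\<^sup>2 * d = ((real k + 1) * (real k + 2) - \<mu>) * c"
        by (simp add: add.commute)
      have nths: "fps_nth F2 k = (real k + 1) * (real k + 2) * d"
        "fps_nth (?X * F2) k = real k * (real k + 1) * c"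
        "fps_nth F1 (Suc k) = (real k + 2) * d"
        "fps_nth F1 k = (real k + 1) * c" "fps_nth F (Suc k) = c"
        by (cases k; simp add: F1_def F2_def F_def c_def d_def algebra_simps
            del: riemann_coeff.simps(2))+
      have "fps_nth (?X * F2 - ?X * (?X * F2) + F1 - fps_const 2 * (?X * F1) + fps_const \<mu> * F) (Suc k)
          = fps_nth F2 k - fps_nth (?X * F2) k + fps_nth F1 (Suc k) - 2 * fps_nth F1 k + \<mu> * fps_nth F (Suc k)"
        by simp
      also have "\<dots> = 0"
        unfolding nths using rec by (simp add: algebra_simps power2_eq_square)
      finally show ?thesis using Suc by simp
    qed
  qed
  have ode: "s * (1 - s) * eval_fps F2 s + (1 - 2 * s) * eval_fps F1 s + \<mu> * eval_fps F s = 0"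
    if s: "\<bar>s\<bar> < r" for s
  proof -
    have conv: "ereal \<bar>s\<bar> < fps_conv_radius (f + g)" "ereal \<bar>s\<bar> < fps_conv_radius (f - g)"
        "ereal \<bar>s\<bar> < fps_conv_radius (f * g)"
      if "ereal \<bar>s\<bar> < fps_conv_radius f" "ereal \<bar>s\<bar> < fps_conv_radius g" for f g :: "real fps"
      using that order.strict_trans2[OF _ fps_conv_radius_add[of f g]]
        order.strict_trans2[OF _ fps_conv_radius_diff[of f g]]
        order.strict_trans2[OF _ fps_conv_radius_mult[of f g]] by auto
    have "eval_fps (?X * F2 - ?X * (?X * F2) + F1 - fps_const 2 * (?X * F1) + fps_const \<mu> * F) s = 0"
      by (simp only: fps_ode eval_fps_0)
    also have "eval_fps (?X * F2 - ?X * (?X * F2) + F1 - fps_const 2 * (?X * F1) + fps_const \<mu> * F) s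
      = s * eval_fps F2 s - s * (s * eval_fps F2 s) + eval_fps F1 s - 2 * (s * eval_fps F1 s) + \<mu> * eval_fps F s"
      using in_rad[OF s] by (simp add: eval_fps_add eval_fps_diff eval_fps_mult conv)
    finally show ?thesis by (simp add: algebra_simps)
  qed
  show ?thesis
  proof
    show "(eval_fps F has_real_derivative eval_fps F1 s) (at s)" if "\<bar>s\<bar> < r" for s
      unfolding F1_def by (rule has_field_derivative_eval_fps) (use in_rad[OF that] in simp)
    show "(eval_fps F1 has_real_derivative eval_fps F2 s) (at s)" if "\<bar>s\<bar> < r" for s
      unfolding F2_def by (rule has_field_derivative_eval_fps) (use in_rad[OF that] in simp)
    show "continuous_on {-r<..<r} (eval_fps F2)"
      by (rule continuous_on_eval_fps')
        (use in_rad in \<open>auto intro!: continuous_intros simp: eball_def\<close>)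
    show "eval_fps F 0 = 1" by (simp add: eval_fps_at_0 F_def)
  qed (use ode in auto)
qed

section \<open>Riemann's formula for the wave equation with inverse-square potential\<close>

definition kernel_partials ::
  "real set \<Rightarrow> real set \<Rightarrow> real set \<Rightarrow> (real \<Rightarrow> real \<Rightarrow> real \<Rightarrow> real) \<Rightarrow>
   (real \<Rightarrow> real \<Rightarrow> real \<Rightarrow> real) \<Rightarrow> (real \<Rightarrow> real \<Rightarrow> real \<Rightarrow> real) \<Rightarrow> bool" where
  "kernel_partials A B C k kt kz \<longleftrightarrow>
     (\<forall>t\<in>A. \<forall>z\<in>B. \<forall>y\<in>C. ((\<lambda>t. k t z y) has_real_derivative kt t z y) (at t within A) \<and>
                         ((\<lambda>z. k t z y) has_real_derivative kz t z y) (at z within B)) \<and>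
     continuous_on ((A \<times> B) \<times> C) (\<lambda>(s, y). k (fst s) (snd s) y) \<and>
     continuous_on ((A \<times> B) \<times> C) (\<lambda>(s, y). kt (fst s) (snd s) y) \<and>
     continuous_on ((A \<times> B) \<times> C) (\<lambda>(s, y). kz (fst s) (snd s) y)"

text \<open>
  The lower limit \<open>a\<close> is fixed far to the left; the integral over the characteristic
  interval \<open>[z - t, z + t]\<close> is then the difference of the cases \<open>\<epsilon> = 1\<close> and \<open>\<epsilon> = -1\<close>.
\<close>

definition char_integral ::
  "(real \<Rightarrow> real) \<Rightarrow> real \<Rightarrow> real \<Rightarrow> (real \<Rightarrow> real \<Rightarrow> real \<Rightarrow> real) \<Rightarrow> real \<Rightarrow> real \<Rightarrow> real" where
  "char_integral f a \<epsilon> k t z = integral {a..z + \<epsilon> * t} (\<lambda>y. k t z y * f y)"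

lemma partials_on_char_integral:
  assumes k: "kernel_partials A B {a..b} k kt kz"
    and f: "continuous_on {a..b} f"
    and conv: "convex A" "convex B"
    and end_in: "\<And>t z. t \<in> A \<Longrightarrow> z \<in> B \<Longrightarrow> a < z + \<epsilon> * t \<and> z + \<epsilon> * t < b"
  shows "partials_on A B (char_integral f a \<epsilon> k)
     (\<lambda>t z. char_integral f a \<epsilon> kt t z + \<epsilon> * (k t z (z + \<epsilon> * t) * f (z + \<epsilon> * t)))
     (\<lambda>t z. char_integral f a \<epsilon> kz t z + k t z (z + \<epsilon> * t) * f (z + \<epsilon> * t))"
proof -
  have dt: "((\<lambda>t. k t z y) has_real_derivative kt t z y) (at t within A)"
    and dz: "((\<lambda>z. k t z y) has_real_derivative kz t z y) (at z within B)"
    if "t \<in> A" "z \<in> B" "y \<in> {a..b}" for t z y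
    using k that unfolding kernel_partials_def by blast+
  have ck: "continuous_on ((A \<times> B) \<times> {a..b}) (\<lambda>(s, y). k (fst s) (snd s) y)"
    "continuous_on ((A \<times> B) \<times> {a..b}) (\<lambda>(s, y). kt (fst s) (snd s) y)"
    "continuous_on ((A \<times> B) \<times> {a..b}) (\<lambda>(s, y). kz (fst s) (snd s) y)"
    using k unfolding kernel_partials_def by blast+
  have cend: "continuous_on (A \<times> B) (\<lambda>s. snd s + \<epsilon> * fst s)"
    by (intro continuous_intros)
  have end_in': "snd s + \<epsilon> * fst s \<in> {a..b}" if "s \<in> A \<times> B" for s
    using end_in[of "fst s" "snd s"] that by auto
  have cf: "continuous_on (A \<times> B) (\<lambda>s. f (snd s + \<epsilon> * fst s))"
    by (rule continuous_on_compose2[OF f cend]) (use end_in' in auto)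
  have prod: "continuous_on ((A \<times> B) \<times> {a..b}) (\<lambda>(s, y). v (fst s) (snd s) y * f y)"
    if "continuous_on ((A \<times> B) \<times> {a..b}) (\<lambda>(s, y). v (fst s) (snd s) y)" for v
    using that unfolding case_prod_unfold
    by (intro continuous_on_mult continuous_on_compose2[OF f]) (auto intro: continuous_intros)
  have diag: "continuous_on (A \<times> B) (\<lambda>s. k (fst s) (snd s) (snd s + \<epsilon> * fst s))"
  proof -
    have "(\<lambda>s. (s, snd s + \<epsilon> * fst s)) ` (A \<times> B) \<subseteq> (A \<times> B) \<times> {a..b}"
      by (intro image_subsetI SigmaI end_in')
    from continuous_on_compose2[OF ck(1) continuous_on_Pair[OF continuous_on_id cend] this]
    show ?thesis by simp
  qed
  have J: "continuous_on (A \<times> B) (\<lambda>s. char_integral f a \<epsilon> v (fst s) (snd s))"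
    if "continuous_on ((A \<times> B) \<times> {a..b}) (\<lambda>(s, y). v (fst s) (snd s) y)" for v
    unfolding char_integral_def
    by (rule continuous_on_moving_integral[OF prod[OF that] cend]) (use end_in' in auto)
  have slice_t: "continuous_on (A \<times> {a..b}) (\<lambda>(t, y). v t z y * f y)"
    if "continuous_on ((A \<times> B) \<times> {a..b}) (\<lambda>(s, y). v (fst s) (snd s) y)" "z \<in> B" for v z
  proof -
    have c: "continuous_on (A \<times> {a..b}) (\<lambda>s. ((fst s, z), snd s))"
      by (intro continuous_intros)
    have "(\<lambda>s. ((fst s, z), snd s)) ` (A \<times> {a..b}) \<subseteq> (A \<times> B) \<times> {a..b}"
      using that(2) by auto
    from continuous_on_compose2[OF prod[OF that(1)] c this] show ?thesis
      by (simp add: case_prod_unfold)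
  qed
  have slice_z: "continuous_on (B \<times> {a..b}) (\<lambda>(z, y). v t z y * f y)"
    if "continuous_on ((A \<times> B) \<times> {a..b}) (\<lambda>(s, y). v (fst s) (snd s) y)" "t \<in> A" for v t
  proof -
    have c: "continuous_on (B \<times> {a..b}) (\<lambda>s. ((t, fst s), snd s))"
      by (intro continuous_intros)
    have "(\<lambda>s. ((t, fst s), snd s)) ` (B \<times> {a..b}) \<subseteq> (A \<times> B) \<times> {a..b}"
      using that(2) by auto
    from continuous_on_compose2[OF prod[OF that(1)] c this] show ?thesis
      by (simp add: case_prod_unfold)
  qed
  show ?thesis
    unfolding partials_on_def
  proof (intro conjI ballI)
    fix t z assume t: "t \<in> A" and z: "z \<in> B"
    have "((\<lambda>t. integral {a..z + \<epsilon> * t} (\<lambda>y. k t z y * f y)) has_real_derivative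
        integral {a..z + \<epsilon> * t} (\<lambda>y. kt t z y * f y) + k t z (z + \<epsilon> * t) * f (z + \<epsilon> * t) * \<epsilon>) (at t within A)"
      by (rule DERIV_moving_integral[OF _ slice_t[OF ck(1) z] slice_t[OF ck(2) z] t conv(1)])
        (use z end_in in \<open>auto intro!: DERIV_cmult_right dt derivative_eq_intros\<close>)
    then show "((\<lambda>t. char_integral f a \<epsilon> k t z) has_real_derivative
        char_integral f a \<epsilon> kt t z + \<epsilon> * (k t z (z + \<epsilon> * t) * f (z + \<epsilon> * t))) (at t within A)"
      by (simp add: char_integral_def mult_ac)
    have "((\<lambda>z. integral {a..z + \<epsilon> * t} (\<lambda>y. k t z y * f y)) has_real_derivative
        integral {a..z + \<epsilon> * t} (\<lambda>y. kz t z y * f y) + k t z (z + \<epsilon> * t) * f (z + \<epsilon> * t) * 1) (at z within B)"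
      by (rule DERIV_moving_integral[OF _ slice_z[OF ck(1) t] slice_z[OF ck(3) t] z conv(2)])
        (use t end_in in \<open>auto intro!: DERIV_cmult_right dz derivative_eq_intros\<close>)
    then show "((\<lambda>z. char_integral f a \<epsilon> k t z) has_real_derivative
        char_integral f a \<epsilon> kz t z + k t z (z + \<epsilon> * t) * f (z + \<epsilon> * t)) (at z within B)"
      by (simp add: char_integral_def)
  qed (use ck in \<open>auto simp: case_prod_unfold intro!: continuous_intros J cf diag\<close>)
qed

lemma partials_on_travelling:
  assumes f: "\<And>y. (f has_real_derivative f' y) (at y)" "continuous_on UNIV f'"
  shows "partials_on A B (\<lambda>t z. f (z + \<epsilon> * t)) (\<lambda>t z. \<epsilon> * f' (z + \<epsilon> * t)) (\<lambda>t z. f' (z + \<epsilon> * t))"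
proof -
  have cf: "continuous_on UNIV f"
    using f(1) by (intro DERIV_continuous_on)
  have c: "continuous_on (A \<times> B) (\<lambda>s. g (snd s + \<epsilon> * fst s))" if "continuous_on UNIV g" for g :: "real \<Rightarrow> real"
    by (rule continuous_on_compose2[OF that]) (auto intro!: continuous_intros)
  show ?thesis
    unfolding partials_on_def case_prod_unfold
    by (auto intro!: continuous_intros c cf f(2) DERIV_cong[OF DERIV_chain2[OF f(1)]] derivative_eq_intros)
qed

text \<open>
  The numerator is the squared Lorentz distance of \<open>(t, z)\<close> and \<open>(0, y)\<close>, so that \<open>lorentz\<close> vanishes
  on the characteristics; the denominator makes it invariant under scaling, as is the equation with
  the potential \<open>\<mu> / z\<^sup>2\<close>.
\<close>

definition lorentz :: "real \<Rightarrow> real \<Rightarrow> real \<Rightarrow> real" where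
  "lorentz t z y = (t\<^sup>2 - (z - y)\<^sup>2) / (4 * z * y)"

lemma DERIV_lorentz:
  assumes "z \<noteq> 0" "y \<noteq> 0"
  shows "((\<lambda>t. lorentz t z y) has_real_derivative t / (2 * z * y)) (at t within S)"
    and "((\<lambda>z. lorentz t z y) has_real_derivative (y\<^sup>2 - t\<^sup>2 - z\<^sup>2) / (4 * z\<^sup>2 * y)) (at z within S)"
  unfolding lorentz_def using assms
  by (auto intro!: derivative_eq_intros simp: field_simps power2_eq_square)

text \<open>
  Riemann's formula. With \<open>\<sigma> = lorentz t z y\<close> the identities \<open>\<sigma>_t\<^sup>2 - \<sigma>_z\<^sup>2 = \<sigma> (1 - \<sigma>) / z\<^sup>2\<close> and
  \<open>\<sigma>_tt - \<sigma>_zz = (1 - 2 \<sigma>) / z\<^sup>2\<close> turn the wave operator on \<open>G \<sigma>\<close> into the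
  hypergeometric one. The terms from the moving end points cancel between \<open>w_tt\<close> and \<open>w_zz\<close>, because
  there \<open>G \<sigma> = 1\<close> and the \<open>t\<close>- and \<open>z\<close>-derivatives of the kernel agree up to the sign of the
  characteristic. The assumption \<open>small\<close> keeps \<open>\<sigma>\<close> in the disc of convergence: it says that the window
  \<open>(l,h)\<close> is narrow compared with its distance from the origin.
\<close>

lemma bessel_wave_local:
  fixes \<mu> T l h :: real and f f' :: "real \<Rightarrow> real"
  assumes T: "T > 0" and lT: "T < l" and lh: "l < h"
    and small: "(h - l + T)\<^sup>2 < 4 * (l - T)\<^sup>2 * (1 / (1 + \<bar>\<mu>\<bar>))"
    and f: "\<And>y. (f has_real_derivative f' y) (at y)" "continuous_on UNIV f'"
  obtains w wt wz wtt wtz wzt wzz where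
    "partials_on {0..T} {l<..<h} w wt wz"
    "partials_on {0..T} {l<..<h} wt wtt wtz"
    "partials_on {0..T} {l<..<h} wz wzt wzz"
    "\<And>t z. t \<in> {0..T} \<Longrightarrow> z \<in> {l<..<h} \<Longrightarrow> wtt t z = wzz t z - \<mu> / z\<^sup>2 * w t z"
    "\<And>z. z \<in> {l<..<h} \<Longrightarrow> w 0 z = 0 \<and> wt 0 z = f z"
    "\<And>t z. t \<in> {0..T} \<Longrightarrow> z \<in> {l<..<h} \<Longrightarrow> (\<And>y. \<bar>y - z\<bar> \<le> t \<Longrightarrow> f y = 0) \<Longrightarrow> w t z = 0"
proof -
  define r where "r = 1 / (1 + \<bar>\<mu>\<bar>)"
  obtain G G1 G2 :: "real \<Rightarrow> real" where
    G: "\<And>s. \<bar>s\<bar> < r \<Longrightarrow> (G has_real_derivative G1 s) (at s)"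
    and G1: "\<And>s. \<bar>s\<bar> < r \<Longrightarrow> (G1 has_real_derivative G2 s) (at s)"
    and G2: "continuous_on {-r<..<r} G2"
    and ode: "\<And>s. \<bar>s\<bar> < r \<Longrightarrow> s * (1 - s) * G2 s + (1 - 2 * s) * G1 s + \<mu> * G s = 0"
    and G0: "G 0 = 1"
    using riemann_profile_exists[of \<mu>] unfolding r_def[symmetric] by blast
  let ?A = "{0..T}" and ?B = "{l<..<h}" and ?C = "{l - T..h + T}"
  have pos: "z > 0" "y > 0" if "z \<in> ?B" "y \<in> ?C" for z y
    using that T lT by auto
  have cone: "\<bar>lorentz t z y\<bar> < r" if "t \<in> ?A" "z \<in> ?B" "y \<in> ?C" for t z y
  proof -
    have "t\<^sup>2 \<le> (h - l + T)\<^sup>2" using that lh by (intro power_mono) auto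
    moreover have "(z - y)\<^sup>2 \<le> (h - l + T)\<^sup>2"
      using that by (intro power2_le_iff_abs_le[THEN iffD2]) auto
    moreover have "t\<^sup>2 \<ge> 0" "(z - y)\<^sup>2 \<ge> 0" by auto
    ultimately have "\<bar>t\<^sup>2 - (z - y)\<^sup>2\<bar> \<le> (h - l + T)\<^sup>2" by linarith
    also have "\<dots> < 4 * (l - T)\<^sup>2 * r" using small by (simp add: r_def)
    also have "\<dots> \<le> 4 * z * y * r"
    proof -
      have "(l - T) * (l - T) \<le> z * y" using that T lT by (intro mult_mono) auto
      then show ?thesis
        by (intro mult_right_mono) (auto simp: r_def power2_eq_square)
    qed
    finally show ?thesis
      using pos[OF that(2,3)] unfolding lorentz_def
      by (simp add: abs_divide abs_mult divide_less_eq mult.commute)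
  qed
  define K where "K = (\<lambda>t z y. G (lorentz t z y))"
  define Kt where "Kt = (\<lambda>t z y. G1 (lorentz t z y) * (t / (2 * z * y)))"
  define Kz where "Kz = (\<lambda>t z y. G1 (lorentz t z y) * ((y\<^sup>2 - t\<^sup>2 - z\<^sup>2) / (4 * z\<^sup>2 * y)))"
  define Ktt where "Ktt = (\<lambda>t z y. G2 (lorentz t z y) * (t / (2 * z * y))\<^sup>2 + G1 (lorentz t z y) / (2 * z * y))"
  define Ktz where "Ktz = (\<lambda>t z y. G2 (lorentz t z y) * ((y\<^sup>2 - t\<^sup>2 - z\<^sup>2) / (4 * z\<^sup>2 * y)) * (t / (2 * z * y))
      - G1 (lorentz t z y) * (t / (2 * z\<^sup>2 * y)))"
  define Kzz where "Kzz = (\<lambda>t z y. G2 (lorentz t z y) * ((y\<^sup>2 - t\<^sup>2 - z\<^sup>2) / (4 * z\<^sup>2 * y))\<^sup>2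
      + G1 (lorentz t z y) * ((t\<^sup>2 - y\<^sup>2) / (2 * z ^ 3 * y)))"
  have dG: "((\<lambda>t. G (lorentz t z y)) has_real_derivative G1 (lorentz t z y) * (t / (2 * z * y))) (at t within ?A)"
      "((\<lambda>z. G (lorentz t z y)) has_real_derivative
        G1 (lorentz t z y) * ((y\<^sup>2 - t\<^sup>2 - z\<^sup>2) / (4 * z\<^sup>2 * y))) (at z within ?B)"
      "((\<lambda>t. G1 (lorentz t z y)) has_real_derivative G2 (lorentz t z y) * (t / (2 * z * y))) (at t within ?A)"
      "((\<lambda>z. G1 (lorentz t z y)) has_real_derivative
        G2 (lorentz t z y) * ((y\<^sup>2 - t\<^sup>2 - z\<^sup>2) / (4 * z\<^sup>2 * y))) (at z within ?B)"
    if *: "t \<in> ?A" "z \<in> ?B" "y \<in> ?C" for t z y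
  proof -
    have nz: "z \<noteq> 0" "y \<noteq> 0" using pos[OF *(2,3)] by auto
    show "((\<lambda>t. G (lorentz t z y)) has_real_derivative G1 (lorentz t z y) * (t / (2 * z * y))) (at t within ?A)"
      "((\<lambda>z. G (lorentz t z y)) has_real_derivative
        G1 (lorentz t z y) * ((y\<^sup>2 - t\<^sup>2 - z\<^sup>2) / (4 * z\<^sup>2 * y))) (at z within ?B)"
      "((\<lambda>t. G1 (lorentz t z y)) has_real_derivative G2 (lorentz t z y) * (t / (2 * z * y))) (at t within ?A)"
      "((\<lambda>z. G1 (lorentz t z y)) has_real_derivative
        G2 (lorentz t z y) * ((y\<^sup>2 - t\<^sup>2 - z\<^sup>2) / (4 * z\<^sup>2 * y))) (at z within ?B)"
      by (fact DERIV_chain2[where f=G and g="\<lambda>t. lorentz t z y", OF G[OF cone[OF *]] DERIV_lorentz(1)[OF nz]]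
          DERIV_chain2[where f=G and g="\<lambda>z. lorentz t z y", OF G[OF cone[OF *]] DERIV_lorentz(2)[OF nz]]
          DERIV_chain2[where f=G1 and g="\<lambda>t. lorentz t z y", OF G1[OF cone[OF *]] DERIV_lorentz(1)[OF nz]]
          DERIV_chain2[where f=G1 and g="\<lambda>z. lorentz t z y", OF G1[OF cone[OF *]] DERIV_lorentz(2)[OF nz]])+
  qed
  let ?S = "(?A \<times> ?B) \<times> ?C"
  have c_lor: "continuous_on ?S (\<lambda>s. lorentz (fst (fst s)) (snd (fst s)) (snd s))"
    unfolding lorentz_def using T lT by (auto intro!: continuous_intros)
  have c_G: "continuous_on ?S (\<lambda>s. g (lorentz (fst (fst s)) (snd (fst s)) (snd s)))"
    if "continuous_on {-r<..<r} g" for g :: "real \<Rightarrow> real"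
  proof (rule continuous_on_compose2[OF that c_lor], rule image_subsetI)
    fix s assume "s \<in> ?S"
    then have "\<bar>lorentz (fst (fst s)) (snd (fst s)) (snd s)\<bar> < r" by (intro cone) auto
    then show "lorentz (fst (fst s)) (snd (fst s)) (snd s) \<in> {-r<..<r}" by (simp add: abs_less_iff)
  qed
  have cG: "continuous_on {-r<..<r} G" "continuous_on {-r<..<r} G1"
    by (auto intro!: continuous_at_imp_continuous_on DERIV_isCont[OF G] DERIV_isCont[OF G1])
  note conts = c_G[OF cG(1)] c_G[OF cG(2)] c_G[OF G2]
  have K: "kernel_partials ?A ?B ?C K Kt Kz"
    unfolding kernel_partials_def
  proof (intro conjI ballI)
    fix t z y assume *: "t \<in> ?A" "z \<in> ?B" "y \<in> ?C"
    show "((\<lambda>t. K t z y) has_real_derivative Kt t z y) (at t within ?A)"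
      unfolding K_def Kt_def by (rule dG(1)[OF *])
    show "((\<lambda>z. K t z y) has_real_derivative Kz t z y) (at z within ?B)"
      unfolding K_def Kz_def by (rule dG(2)[OF *])
  qed (use T lT in \<open>auto simp: K_def Kt_def Kz_def case_prod_unfold intro!: continuous_intros conts\<close>)
  have Kt: "kernel_partials ?A ?B ?C Kt Ktt Ktz"
    unfolding kernel_partials_def
  proof (intro conjI ballI)
    fix t z y assume *: "t \<in> ?A" "z \<in> ?B" "y \<in> ?C"
    have nz: "z \<noteq> 0" "y \<noteq> 0" using pos[OF *(2,3)] by auto
    have "((\<lambda>t. G1 (lorentz t z y)) has_real_derivative G2 (lorentz t z y) * (t / (2 * z * y))) (at t within ?A)"
      by (rule dG[OF *])
    from DERIV_mult[OF this DERIV_cdivide[OF DERIV_ident, of "2 * z * y"]]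
    show "((\<lambda>t. Kt t z y) has_real_derivative Ktt t z y) (at t within ?A)"
      unfolding Kt_def Ktt_def by (rule DERIV_cong) (simp add: power2_eq_square)
    have "((\<lambda>z. G1 (lorentz t z y)) has_real_derivative
        G2 (lorentz t z y) * ((y\<^sup>2 - t\<^sup>2 - z\<^sup>2) / (4 * z\<^sup>2 * y))) (at z within ?B)"
      by (rule dG[OF *])
    moreover have "((\<lambda>z. t / (2 * z * y)) has_real_derivative - (t / (2 * z\<^sup>2 * y))) (at z within ?B)"
      using nz by (auto intro!: derivative_eq_intros simp: field_simps power2_eq_square)
    ultimately have "((\<lambda>z. G1 (lorentz t z y) * (t / (2 * z * y))) has_real_derivative
        G2 (lorentz t z y) * ((y\<^sup>2 - t\<^sup>2 - z\<^sup>2) / (4 * z\<^sup>2 * y)) * (t / (2 * z * y))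
        + - (t / (2 * z\<^sup>2 * y)) * G1 (lorentz t z y)) (at z within ?B)"
      by (rule DERIV_mult)
    then show "((\<lambda>z. Kt t z y) has_real_derivative Ktz t z y) (at z within ?B)"
      unfolding Kt_def Ktz_def by (rule DERIV_cong) (simp add: mult_ac)
  qed (use T lT in \<open>auto simp: Kt_def Ktt_def Ktz_def case_prod_unfold intro!: continuous_intros conts\<close>)
  have Kz: "kernel_partials ?A ?B ?C Kz Ktz Kzz"
    unfolding kernel_partials_def
  proof (intro conjI ballI)
    fix t z y assume *: "t \<in> ?A" "z \<in> ?B" "y \<in> ?C"
    have nz: "z \<noteq> 0" "y \<noteq> 0" using pos[OF *(2,3)] by auto
    have "((\<lambda>t. G1 (lorentz t z y)) has_real_derivative G2 (lorentz t z y) * (t / (2 * z * y))) (at t within ?A)"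
      by (rule dG[OF *])
    moreover have "((\<lambda>t. (y\<^sup>2 - t\<^sup>2 - z\<^sup>2) / (4 * z\<^sup>2 * y)) has_real_derivative - (t / (2 * z\<^sup>2 * y))) (at t within ?A)"
      using nz by (auto intro!: derivative_eq_intros simp: field_simps power2_eq_square)
    ultimately have "((\<lambda>t. G1 (lorentz t z y) * ((y\<^sup>2 - t\<^sup>2 - z\<^sup>2) / (4 * z\<^sup>2 * y))) has_real_derivative
        G2 (lorentz t z y) * (t / (2 * z * y)) * ((y\<^sup>2 - t\<^sup>2 - z\<^sup>2) / (4 * z\<^sup>2 * y))
        + - (t / (2 * z\<^sup>2 * y)) * G1 (lorentz t z y)) (at t within ?A)"
      by (rule DERIV_mult)
    then show "((\<lambda>t. Kz t z y) has_real_derivative Ktz t z y) (at t within ?A)"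
      unfolding Kz_def Ktz_def by (rule DERIV_cong) (simp add: mult_ac)
    have "((\<lambda>z. G1 (lorentz t z y)) has_real_derivative
        G2 (lorentz t z y) * ((y\<^sup>2 - t\<^sup>2 - z\<^sup>2) / (4 * z\<^sup>2 * y))) (at z within ?B)"
      by (rule dG[OF *])
    moreover have "((\<lambda>z. (y\<^sup>2 - t\<^sup>2 - z\<^sup>2) / (4 * z\<^sup>2 * y)) has_real_derivative (t\<^sup>2 - y\<^sup>2) / (2 * z ^ 3 * y)) (at z within ?B)"
      using nz by (auto intro!: derivative_eq_intros simp: field_simps power2_eq_square power3_eq_cube)
    ultimately have "((\<lambda>z. G1 (lorentz t z y) * ((y\<^sup>2 - t\<^sup>2 - z\<^sup>2) / (4 * z\<^sup>2 * y))) has_real_derivative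
        G2 (lorentz t z y) * ((y\<^sup>2 - t\<^sup>2 - z\<^sup>2) / (4 * z\<^sup>2 * y)) * ((y\<^sup>2 - t\<^sup>2 - z\<^sup>2) / (4 * z\<^sup>2 * y))
        + (t\<^sup>2 - y\<^sup>2) / (2 * z ^ 3 * y) * G1 (lorentz t z y)) (at z within ?B)"
      by (rule DERIV_mult)
    then show "((\<lambda>z. Kz t z y) has_real_derivative Kzz t z y) (at z within ?B)"
      unfolding Kz_def Kzz_def by (rule DERIV_cong) (simp add: power2_eq_square mult_ac)
  qed (use T lT in \<open>auto simp: Kz_def Ktz_def Kzz_def case_prod_unfold intro!: continuous_intros conts\<close>)
  have kernel_eq: "Ktt t z y - Kzz t z y = - (\<mu> / z\<^sup>2 * K t z y)"
    if *: "t \<in> ?A" "z \<in> ?B" "y \<in> ?C" for t z y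
  proof -
    have nz: "z \<noteq> 0" "y \<noteq> 0" using pos[OF *(2,3)] by auto
    define \<sigma> where "\<sigma> = lorentz t z y"
    have t2: "t\<^sup>2 = 4 * z * y * \<sigma> + (z - y)\<^sup>2"
      using nz by (simp add: \<sigma>_def lorentz_def)
    have 1: "(t / (2 * z * y))\<^sup>2 - ((y\<^sup>2 - t\<^sup>2 - z\<^sup>2) / (4 * z\<^sup>2 * y))\<^sup>2 = \<sigma> * (1 - \<sigma>) / z\<^sup>2"
      unfolding power_divide t2 using nz by (simp add: field_simps power2_eq_square)
    have 2: "1 / (2 * z * y) - (t\<^sup>2 - y\<^sup>2) / (2 * z ^ 3 * y) = (1 - 2 * \<sigma>) / z\<^sup>2"
      unfolding t2 using nz by (simp add: field_simps power2_eq_square power3_eq_cube)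
    have "Ktt t z y - Kzz t z y
      = G2 \<sigma> * ((t / (2 * z * y))\<^sup>2 - ((y\<^sup>2 - t\<^sup>2 - z\<^sup>2) / (4 * z\<^sup>2 * y))\<^sup>2)
        + G1 \<sigma> * (1 / (2 * z * y) - (t\<^sup>2 - y\<^sup>2) / (2 * z ^ 3 * y))"
      by (simp add: Ktt_def Kzz_def \<sigma>_def algebra_simps)
    also have "\<dots> = (\<sigma> * (1 - \<sigma>) * G2 \<sigma> + (1 - 2 * \<sigma>) * G1 \<sigma>) / z\<^sup>2"
      unfolding 1 2 by (simp add: add_divide_distrib mult_ac)
    also have "\<sigma> * (1 - \<sigma>) * G2 \<sigma> + (1 - 2 * \<sigma>) * G1 \<sigma> = - (\<mu> * G \<sigma>)"
      using ode[OF cone[OF *]] by (simp add: \<sigma>_def)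
    finally show ?thesis by (simp add: K_def \<sigma>_def)
  qed
  have cf: "continuous_on S f" for S
    using f(1) by (meson DERIV_continuous_on DERIV_subset subset_UNIV)
  have ends: "l - T < z + \<epsilon> * t \<and> z + \<epsilon> * t < h + T" if "t \<in> ?A" "z \<in> ?B" "\<epsilon> = 1 \<or> \<epsilon> = -1" for t z \<epsilon>
    using that by auto
  have diag: "lorentz t z (z + \<epsilon> * t) = 0" if "\<epsilon> = 1 \<or> \<epsilon> = -1" for t z \<epsilon>
    using that by (auto simp: lorentz_def)
  define J where "J = char_integral f (l - T)"
  have J_partials: "partials_on ?A ?B (J \<epsilon> k)
     (\<lambda>t z. J \<epsilon> kt t z + \<epsilon> * (k t z (z + \<epsilon> * t) * f (z + \<epsilon> * t)))
     (\<lambda>t z. J \<epsilon> kz t z + k t z (z + \<epsilon> * t) * f (z + \<epsilon> * t))"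
    if "kernel_partials ?A ?B ?C k kt kz" "\<epsilon> = 1 \<or> \<epsilon> = -1" for k kt kz \<epsilon>
    unfolding J_def using ends that(2) by (intro partials_on_char_integral[OF that(1) cf]) auto
  have J_plus: "partials_on ?A ?B (J 1 k) (\<lambda>t z. J 1 kt t z + k t z (z + t) * f (z + t))
      (\<lambda>t z. J 1 kz t z + k t z (z + t) * f (z + t))"
    and J_minus: "partials_on ?A ?B (J (-1) k) (\<lambda>t z. J (-1) kt t z - k t z (z - t) * f (z - t))
      (\<lambda>t z. J (-1) kz t z + k t z (z - t) * f (z - t))"
    if "kernel_partials ?A ?B ?C k kt kz" for k kt kz
    using J_partials[OF that, of 1] J_partials[OF that, of "-1"] by simp_all
  define w where "w = (\<lambda>t z. 1/2 * (J 1 K t z - J (-1) K t z))"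
  define wt where "wt = (\<lambda>t z. 1/2 * (J 1 Kt t z - J (-1) Kt t z + (f (z + t) + f (z - t))))"
  define wz where "wz = (\<lambda>t z. 1/2 * (J 1 Kz t z - J (-1) Kz t z + (f (z + t) - f (z - t))))"
  define wtt where "wtt = (\<lambda>t z. 1/2 * (J 1 Ktt t z - J (-1) Ktt t z
      + (Kt t z (z + t) * f (z + t) + Kt t z (z - t) * f (z - t))
      + (f' (z + t) - f' (z - t))))"
  define wtz where "wtz = (\<lambda>t z. 1/2 * (J 1 Ktz t z - J (-1) Ktz t z
      + (Kt t z (z + t) * f (z + t) - Kt t z (z - t) * f (z - t))
      + (f' (z + t) + f' (z - t))))"
  define wzt where "wzt = (\<lambda>t z. 1/2 * (J 1 Ktz t z - J (-1) Ktz t z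
      + (Kz t z (z + t) * f (z + t) + Kz t z (z - t) * f (z - t))
      + (f' (z + t) + f' (z - t))))"
  define wzz where "wzz = (\<lambda>t z. 1/2 * (J 1 Kzz t z - J (-1) Kzz t z
      + (Kz t z (z + t) * f (z + t) - Kz t z (z - t) * f (z - t))
      + (f' (z + t) - f' (z - t))))"
  have K1: "K t z (z + t) = 1" "K t z (z - t) = 1" for t z
    using diag[of 1] diag[of "-1"] by (auto simp: K_def G0)
  have w: "partials_on ?A ?B w wt wz"
    by (rule partials_on_cong[OF partials_on_cmult[OF
        partials_on_diff[OF J_plus[OF K] J_minus[OF K]], of "1/2"]])
      (auto simp: w_def wt_def wz_def K1)
  have f_plus: "partials_on ?A ?B (\<lambda>t z. f (z + t)) (\<lambda>t z. f' (z + t)) (\<lambda>t z. f' (z + t))"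
    using partials_on_travelling[OF f, of ?A ?B 1] by simp
  have f_minus: "partials_on ?A ?B (\<lambda>t z. f (z - t)) (\<lambda>t z. - f' (z - t)) (\<lambda>t z. f' (z - t))"
    using partials_on_travelling[OF f, of ?A ?B "-1"] by simp
  have wt: "partials_on ?A ?B wt wtt wtz"
    by (rule partials_on_cong[OF partials_on_cmult[OF partials_on_add[OF
        partials_on_diff[OF J_plus[OF Kt] J_minus[OF Kt]] partials_on_add[OF f_plus f_minus]], of "1/2"]])
      (auto simp: wt_def wtt_def wtz_def)
  have wz: "partials_on ?A ?B wz wzt wzz"
    by (rule partials_on_cong[OF partials_on_cmult[OF partials_on_add[OF
        partials_on_diff[OF J_plus[OF Kz] J_minus[OF Kz]] partials_on_diff[OF f_plus f_minus]], of "1/2"]])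
      (auto simp: wz_def wzt_def wzz_def)
  have slice: "continuous_on {l - T..b} (k t z)"
    if "continuous_on ?S (\<lambda>(s, y). k (fst s) (snd s) y)" "t \<in> ?A" "z \<in> ?B" "b \<le> h + T" for k t z b
  proof -
    have c: "continuous_on {l - T..b} (\<lambda>y. ((t, z), y))"
      by (intro continuous_on_Pair continuous_on_const continuous_on_id)
    have "(\<lambda>y. ((t, z), y)) ` {l - T..b} \<subseteq> ?S" using that(2-4) by auto
    from continuous_on_compose2[OF that(1) c this] show ?thesis by simp
  qed
  show ?thesis
  proof (rule that[OF w wt wz])
    fix t z assume t: "t \<in> ?A" and z: "z \<in> ?B"
    have Jdiff: "J \<epsilon> Ktt t z - J \<epsilon> Kzz t z = - (\<mu> / z\<^sup>2 * J \<epsilon> K t z)" if \<epsilon>: "\<epsilon> = 1 \<or> \<epsilon> = -1" for \<epsilon>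
    proof -
      have I: "(\<lambda>y. k t z y * f y) integrable_on {l - T..z + \<epsilon> * t}"
        if "continuous_on ?S (\<lambda>(s, y). k (fst s) (snd s) y)" for k
        using ends[OF t z \<epsilon>]
        by (intro integrable_continuous_real continuous_on_mult cf slice[OF that t z]) simp
      have "J \<epsilon> Ktt t z - J \<epsilon> Kzz t z = integral {l - T..z + \<epsilon> * t} (\<lambda>y. Ktt t z y * f y - Kzz t z y * f y)"
        unfolding J_def char_integral_def
        by (rule integral_diff[symmetric]; rule I) (use Kt Kz in \<open>auto simp: kernel_partials_def\<close>)
      also have "\<dots> = integral {l - T..z + \<epsilon> * t} (\<lambda>y. - (\<mu> / z\<^sup>2) * (K t z y * f y))"
      proof (rule integral_cong)
        fix y assume "y \<in> {l - T..z + \<epsilon> * t}"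
        then have "y \<in> ?C" using ends[OF t z \<epsilon>] by auto
        from kernel_eq[OF t z this]
        show "Ktt t z y * f y - Kzz t z y * f y = - (\<mu> / z\<^sup>2) * (K t z y * f y)"
          by (simp add: left_diff_distrib[symmetric])
      qed
      finally show ?thesis by (simp add: J_def char_integral_def)
    qed
    have edge: "Kt t z (z + \<epsilon> * t) = \<epsilon> * Kz t z (z + \<epsilon> * t)" if \<epsilon>: "\<epsilon> = 1 \<or> \<epsilon> = -1" for \<epsilon>
    proof -
      have "z + \<epsilon> * t \<in> ?C" using ends[OF t z \<epsilon>] by auto
      then have "z > 0" "z + \<epsilon> * t > 0" using pos[OF z] by auto
      moreover have "(z + \<epsilon> * t)\<^sup>2 - t\<^sup>2 - z\<^sup>2 = 2 * \<epsilon> * z * t"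
        using \<epsilon> by (auto simp: power2_eq_square algebra_simps)
      ultimately have "((z + \<epsilon> * t)\<^sup>2 - t\<^sup>2 - z\<^sup>2) / (4 * z\<^sup>2 * (z + \<epsilon> * t)) = \<epsilon> * (t / (2 * z * (z + \<epsilon> * t)))"
        by (simp add: power2_eq_square)
      then show ?thesis unfolding Kt_def Kz_def using \<epsilon> by auto
    qed
    show "wtt t z = wzz t z - \<mu> / z\<^sup>2 * w t z"
      using Jdiff[of 1] Jdiff[of "-1"] edge[of 1] edge[of "-1"]
      unfolding wtt_def wzz_def w_def by (simp add: algebra_simps)
  next
    fix z assume z: "z \<in> ?B"
    have "J 1 k 0 z = J (-1) k 0 z" for k
      by (simp add: J_def char_integral_def)
    then show "w 0 z = 0 \<and> wt 0 z = f z"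
      by (simp add: w_def wt_def)
  next
    fix t z assume t: "t \<in> ?A" and z: "z \<in> ?B" and f0: "\<And>y. \<bar>y - z\<bar> \<le> t \<Longrightarrow> f y = 0"
    have "continuous_on {l - T..z + t} (K t z)"
      using K t z by (intro slice) (auto simp: kernel_partials_def)
    then have "(\<lambda>y. K t z y * f y) integrable_on {l - T..z + t}"
      by (intro integrable_continuous_real continuous_on_mult cf)
    from Henstock_Kurzweil_Integration.integral_combine[OF _ _ this, of "z - t"]
    have "integral {l - T..z - t} (\<lambda>y. K t z y * f y) + integral {z - t..z + t} (\<lambda>y. K t z y * f y)
        = integral {l - T..z + t} (\<lambda>y. K t z y * f y)"
      using t z by auto
    moreover have "integral {z - t..z + t} (\<lambda>y. K t z y * f y) = integral {z - t..z + t} (\<lambda>y. 0)"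
      by (rule integral_cong) (use f0 in auto)
    ultimately show "w t z = 0"
      by (simp add: w_def J_def char_integral_def)
  qed
qed

text \<open>
  The support \<open>[A, A + 1]\<close> is placed so far out that the smallness condition of
  \<open>bessel_wave_local\<close> holds and that waves leaving it do not reach \<open>m\<close> by time \<open>T\<close>.
\<close>

lemma compact_wave_exists:
  fixes T \<mu> m :: real
  assumes T: "T > 0"
  obtains A where "A > m" "A > 0"
    "\<And>f f'. (\<And>y. (f has_real_derivative f' y) (at y)) \<Longrightarrow> continuous_on UNIV f' \<Longrightarrow>
       (\<And>y. y \<notin> {A..A + 1} \<Longrightarrow> f y = 0) \<Longrightarrow>
       \<exists>w wt wz wtt wtz wzt wzz.
         partials_on {0..T} UNIV w wt wz \<and> partials_on {0..T} UNIV wt wtt wtz \<and>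
         partials_on {0..T} UNIV wz wzt wzz \<and>
         (\<forall>t\<in>{0..T}. \<forall>z. wtt t z = wzz t z - \<mu> / z\<^sup>2 * w t z) \<and>
         (\<forall>z. w 0 z = 0 \<and> wt 0 z = f z \<and> wz 0 z = 0) \<and>
         (\<forall>t\<in>{0..T}. \<forall>z. z \<le> m \<or> A + 1 + 2 * T \<le> z \<longrightarrow> w t z = 0 \<and> wz t z = 0)"
proof -
  \<comment> \<open>\<open>R\<close> is the width \<open>h - l + T\<close> that enters the smallness condition: the support has length \<open>1\<close>, the
    window adds \<open>2 * T\<close> on each side.\<close>
  define R where "R = 1 + 5 * T"
  define A where "A = 3 * T + \<bar>m\<bar> + R * (1 + \<bar>\<mu>\<bar>)"
  define l where "l = A - 2 * T"
  define h where "h = A + 1 + 2 * T"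
  have R: "R > 0" using T by (simp add: R_def)
  have RM: "R * (1 + \<bar>\<mu>\<bar>) > 0" using R by simp
  show ?thesis
  proof (rule that[of A])
    show "A > m" "A > 0" using T RM by (auto simp: A_def)
    fix f f' :: "real \<Rightarrow> real"
    assume f: "\<And>y. (f has_real_derivative f' y) (at y)" "continuous_on UNIV f'"
      and f0: "\<And>y. y \<notin> {A..A + 1} \<Longrightarrow> f y = 0"
    have lT: "T < l" using T RM by (simp add: l_def A_def)
    have lh: "l < h" using T by (simp add: l_def h_def)
    have ml: "m \<le> l" using T RM by (simp add: l_def A_def)
    have small: "(h - l + T)\<^sup>2 < 4 * (l - T)\<^sup>2 * (1 / (1 + \<bar>\<mu>\<bar>))"
    proof -
      have hl: "h - l + T = R" by (simp add: h_def l_def R_def)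
      have "R * (1 + \<bar>\<mu>\<bar>) \<le> l - T" by (simp add: l_def A_def)
      then have "(R * (1 + \<bar>\<mu>\<bar>))\<^sup>2 \<le> (l - T)\<^sup>2" using RM by (intro power_mono) auto
      then have *: "4 * (R * (1 + \<bar>\<mu>\<bar>))\<^sup>2 * (1 / (1 + \<bar>\<mu>\<bar>)) \<le> 4 * (l - T)\<^sup>2 * (1 / (1 + \<bar>\<mu>\<bar>))"
        by (intro mult_right_mono) auto
      have "R\<^sup>2 * 1 < R\<^sup>2 * (4 * (1 + \<bar>\<mu>\<bar>))"
        using R by (intro mult_strict_left_mono) auto
      also have "\<dots> = 4 * (R * (1 + \<bar>\<mu>\<bar>))\<^sup>2 * (1 / (1 + \<bar>\<mu>\<bar>))"
        by (simp add: power2_eq_square field_simps)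
      also have "\<dots> \<le> 4 * (l - T)\<^sup>2 * (1 / (1 + \<bar>\<mu>\<bar>))"
        by (rule *)
      finally show ?thesis unfolding hl by (simp only: mult_1_right)
    qed
    obtain w wt wz wtt wtz wzt wzz where
      w: "partials_on {0..T} {l<..<h} w wt wz" and
      wt: "partials_on {0..T} {l<..<h} wt wtt wtz" and
      wz: "partials_on {0..T} {l<..<h} wz wzt wzz" and
      pde: "\<And>t z. t \<in> {0..T} \<Longrightarrow> z \<in> {l<..<h} \<Longrightarrow> wtt t z = wzz t z - \<mu> / z\<^sup>2 * w t z" and
      ic: "\<And>z. z \<in> {l<..<h} \<Longrightarrow> w 0 z = 0 \<and> wt 0 z = f z" and
      cone: "\<And>t z. t \<in> {0..T} \<Longrightarrow> z \<in> {l<..<h} \<Longrightarrow> (\<And>y. \<bar>y - z\<bar> \<le> t \<Longrightarrow> f y = 0) \<Longrightarrow> w t z = 0"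
      using bessel_wave_local[OF T lT lh small f] by metis
    define l' h' where "l' = A - T" and "h' = A + 1 + T"
    have lh': "l < l'" "h' < h" using T by (auto simp: l_def l'_def h_def h'_def)
    have w0: "w t z = 0" if "t \<in> {0..T}" "l < z" "z < h" "z < l' \<or> h' < z" for t z
    proof (rule cone)
      fix y assume "\<bar>y - z\<bar> \<le> t"
      then have "y \<notin> {A..A + 1}" using that by (auto simp: l'_def h'_def)
      then show "f y = 0" by (rule f0)
    qed (use that in auto)
    let ?e = "\<lambda>v t z. if l < z \<and> z < h then v t z else (0::real)"
    have wt0: "wt t z = 0" and wz0: "wz t z = 0"
      if "t \<in> {0..T}" "l < z" "z < h" "z < l' \<or> h' < z" for t z
      by (rule partials_on_extend_0(2)[OF w T lh' _ that], rule w0; assumption)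
        (rule partials_on_extend_0(3)[OF w T lh' _ that], rule w0; assumption)
    have ew: "partials_on {0..T} UNIV (?e w) (?e wt) (?e wz)"
      by (rule partials_on_extend_0(1)[OF w T lh']) (rule w0; assumption)
    have ewt: "partials_on {0..T} UNIV (?e wt) (?e wtt) (?e wtz)"
      by (rule partials_on_extend_0(1)[OF wt T lh']) (rule wt0; assumption)
    have ewz: "partials_on {0..T} UNIV (?e wz) (?e wzt) (?e wzz)"
      by (rule partials_on_extend_0(1)[OF wz T lh']) (rule wz0; assumption)
    have e0: "?e w 0 z = 0 \<and> ?e wt 0 z = f z" for z
      using ic f0 lh' T by (auto simp: l'_def h'_def)
    have T0: "0 \<in> {0..T}" using T by simp
    have "?e wz 0 z = 0" for z
    proof -
      have "(?e w 0 has_real_derivative ?e wz 0 z) (at z)"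
        using partials_onD(2)[OF ew T0 UNIV_I] by simp
      moreover have "?e w 0 = (\<lambda>_. 0)" using e0 by auto
      ultimately have "((\<lambda>_. 0) has_real_derivative ?e wz 0 z) (at z)" by (simp only:)
      then show ?thesis using DERIV_unique[OF _ DERIV_const] by blast
    qed
    then have ic': "\<forall>z. ?e w 0 z = 0 \<and> ?e wt 0 z = f z \<and> ?e wz 0 z = 0"
      using e0 by blast
    have pde': "\<forall>t\<in>{0..T}. \<forall>z. ?e wtt t z = ?e wzz t z - \<mu> / z\<^sup>2 * ?e w t z"
      using pde by auto
    have supp': "\<forall>t\<in>{0..T}. \<forall>z. z \<le> m \<or> A + 1 + 2 * T \<le> z \<longrightarrow> ?e w t z = 0 \<and> ?e wz t z = 0"
      using ml by (auto simp: h_def)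
    show "\<exists>w wt wz wtt wtz wzt wzz.
         partials_on {0..T} UNIV w wt wz \<and> partials_on {0..T} UNIV wt wtt wtz \<and>
         partials_on {0..T} UNIV wz wzt wzz \<and>
         (\<forall>t\<in>{0..T}. \<forall>z. wtt t z = wzz t z - \<mu> / z\<^sup>2 * w t z) \<and>
         (\<forall>z. w 0 z = 0 \<and> wt 0 z = f z \<and> wz 0 z = 0) \<and>
         (\<forall>t\<in>{0..T}. \<forall>z. z \<le> m \<or> A + 1 + 2 * T \<le> z \<longrightarrow> w t z = 0 \<and> wz t z = 0)"
      by (rule exI[of _ "?e w"], rule exI[of _ "?e wt"], rule exI[of _ "?e wz"], rule exI[of _ "?e wtt"],
          rule exI[of _ "?e wtz"], rule exI[of _ "?e wzt"], rule exI[of _ "?e wzz"], intro conjI)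
        (fact ew ewt ewz pde' ic' supp')+
  qed
qed

section \<open>Classical solutions on the strip\<close>

lemma C1_on_strip_iff_partials_on:
  "C1_on_strip T u \<longleftrightarrow> partials_on {0..T} {0<..1} u (dt T u) (dx u)"
  unfolding C1_on_strip_def partials_on_def dt_def dx_def has_real_derivative_iff_has_vector_derivative
  by (meson vector_derivative_works differentiableI_vector)

lemma strip_derivatives:
  fixes T :: real
  assumes T: "T > 0" and u: "partials_on {0..T} {0<..1} u p q" and tx: "t \<in> {0..T}" "x \<in> {0<..1}"
  shows "dt T u t x = p t x" "dx u t x = q t x"
proof -
  have nt: "at t within {0..T} \<noteq> bot"
    using T tx by (simp add: trivial_limit_within islimpt_Icc)
  have "x islimpt {0<..1}"
    using tx islimpt_subset[of x "{0<..<1::real}"] by (simp add: islimpt_Ioc)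
  then have nx: "at x within {0<..1} \<noteq> bot"
    by (simp add: trivial_limit_within)
  show "dt T u t x = p t x"
    unfolding dt_def using partials_onD(1)[OF u tx]
    by (intro vector_derivative_within[OF nt]) (simp add: has_real_derivative_iff_has_vector_derivative)
  show "dx u t x = q t x"
    unfolding dx_def using partials_onD(2)[OF u tx]
    by (intro vector_derivative_within[OF nx]) (simp add: has_real_derivative_iff_has_vector_derivative)
qed

lemma C1_on_stripI:
  fixes T :: real
  assumes "T > 0" "partials_on {0..T} {0<..1} u p q"
  shows "C1_on_strip T u"
  unfolding C1_on_strip_iff_partials_on
  by (rule partials_on_cong[OF assms(2)]) (auto simp: strip_derivatives[OF assms])

lemma dx_flux:
  assumes q: "partials_on {0..T} {0<..1} q qt qx" and tx: "t \<in> {0..T}" "x \<in> {0<..<1}"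
  shows "dx (\<lambda>s y. y powr \<theta> * q s y) t x = x powr \<theta> * qx t x + \<theta> * x powr (\<theta> - 1) * q t x"
proof -
  have x: "x \<in> {0<..1}" using tx by auto
  have "x islimpt {0<..1}"
    using x islimpt_subset[of x "{0<..<1::real}"] by (simp add: islimpt_Ioc)
  then have nx: "at x within {0<..1} \<noteq> bot"
    by (simp add: trivial_limit_within)
  have "((\<lambda>y. y powr \<theta> * q t y) has_real_derivative
      x powr \<theta> * qx t x + \<theta> * x powr (\<theta> - 1) * q t x) (at x within {0<..1})"
    using tx by (auto intro!: derivative_eq_intros partials_onD(2)[OF q tx(1) x] simp: mult_ac)
  then show ?thesis
    unfolding dx_def
    by (intro vector_derivative_within[OF nx]) (simp add: has_real_derivative_iff_has_vector_derivative)
qed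

lemma classical_solution_unique:
  fixes T \<theta> :: real
  assumes T: "T > 0" and \<theta>: "\<theta> > 2"
    and u: "classical_solution T \<theta> u0 u1 u" and v: "classical_solution T \<theta> u0 u1 v"
    and tx: "t \<in> {0..T}" "x \<in> {0<..1}"
  shows "v t x = u t x"
proof -
  have reg: "partials_on {0..T} {0<..1} w (dt T w) (dx w)"
    "partials_on {0..T} {0<..1} (dt T w) (dt T (dt T w)) (dx (dt T w))"
    "partials_on {0..T} {0<..1} (dx w) (dt T (dx w)) (dx (dx w))"
    if "classical_solution T \<theta> u0 u1 w" for w
    using that unfolding classical_solution_def C2_on_strip_def by (auto simp: C1_on_strip_iff_partials_on)
  have pde: "dt T (dt T w) t x = x powr \<theta> * dx (dx w) t x + \<theta> * x powr (\<theta> - 1) * dx w t x"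
    if w: "classical_solution T \<theta> u0 u1 w" and tx: "t \<in> {0<..<T}" "x \<in> {0<..<1}" for w t x
  proof -
    have t: "t \<in> {0..T}" using tx by auto
    have "dt T (dt T w) t x = dx (\<lambda>s y. y powr \<theta> * dx w s y) t x"
      using w tx unfolding classical_solution_def by auto
    then show ?thesis by (simp only: dx_flux[OF reg(3)[OF w] t tx(2)])
  qed
  have "v t x - u t x = 0"
    by (rule wave_unique[OF T \<theta> partials_on_diff[OF reg(1)[OF v] reg(1)[OF u]]
        partials_on_diff[OF reg(2)[OF v] reg(2)[OF u]] partials_on_diff[OF reg(3)[OF v] reg(3)[OF u]] _ _ _ tx])
      (use u v in \<open>auto simp: pde classical_solution_def algebra_simps\<close>)
  then show ?thesis by simp
qed

section \<open>An unobservable wave\<close>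

text \<open>
  The velocity \<open>u1\<close> is chosen as a bump \<open>\<phi>\<close> in \<open>x\<close>, since it has to be smooth there, and is
  pulled back to \<open>f\<close> in the coordinate \<open>z\<close>, where \<open>C\<^sup>1\<close> is enough. The amplitude \<open>x powr (- \<theta> / 4)\<close> removes the
  first-order term of the equation in \<open>z\<close> and leaves a potential \<open>\<mu> / z\<^sup>2\<close>.
\<close>

lemma unobservable_wave:
  fixes T \<theta> :: real
  assumes T: "T > 0" and \<theta>: "\<theta> > 2"
  obtains u1 u where "test_function u1" "\<exists>x\<in>{0<..<1}. u1 x \<noteq> 0"
    "classical_solution T \<theta> (\<lambda>_. 0) u1 u"
    "\<And>t. t \<in> {0..T} \<Longrightarrow> dx u t 1 = 0"
    "\<And>x. x \<in> {0<..<1} \<Longrightarrow> dt T u 0 x = u1 x \<and> dx u 0 x = 0"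
proof -
  define \<kappa> where "\<kappa> = \<theta> / 2 - 1"
  have \<kappa>: "\<kappa> > 0" using \<theta> by (simp add: \<kappa>_def)
  define m where "m = 1 / \<kappa>"
  have m: "m > 0" using \<kappa> by (simp add: m_def)
  define \<zeta> where "\<zeta> = (\<lambda>x::real. x powr (- \<kappa>) / \<kappa>)"
  define \<xi> where "\<xi> = (\<lambda>y::real. (\<kappa> * y) powr (- m))"
  define \<mu> where "\<mu> = m\<^sup>2 * (\<theta> / 4 * (3 * \<theta> / 4 - 1))"
  have d\<zeta>: "(\<zeta> has_real_derivative - (x powr (- \<theta> / 2))) (at x within S)" if "x > 0" for x S
  proof -
    have "(\<zeta> has_real_derivative (- \<kappa> * x powr (- \<kappa> - 1)) / \<kappa>) (at x within S)"
      unfolding \<zeta>_def using that by (auto intro!: derivative_eq_intros)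
    moreover have "- \<kappa> - 1 = - \<theta> / 2" by (simp add: \<kappa>_def)
    ultimately show ?thesis using \<kappa> by simp
  qed
  have \<xi>\<zeta>: "\<xi> (\<zeta> x) = x" "\<zeta> x > 0" if "x > 0" for x
    using that \<kappa> by (simp_all add: \<xi>_def \<zeta>_def m_def powr_powr)
  have \<zeta>\<xi>: "\<zeta> (\<xi> y) = y" "\<xi> y > 0" if "y > 0" for y
    using that \<kappa> by (simp_all add: \<xi>_def \<zeta>_def m_def powr_powr)
  have \<xi>_less: "\<xi> y' < \<xi> y" if "0 < y" "y < y'" for y y'
    unfolding \<xi>_def using that \<kappa> m by (intro powr_less_mono2_neg) auto
  have \<zeta>_le: "\<zeta> x' \<le> \<zeta> x" if "0 < x" "x \<le> x'" for x x'
    unfolding \<zeta>_def using that \<kappa> by (intro divide_right_mono powr_mono2') auto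
  obtain A where A: "A > m" "A > 0" and wave:
    "\<And>f f'. (\<And>y. (f has_real_derivative f' y) (at y)) \<Longrightarrow> continuous_on UNIV f' \<Longrightarrow>
       (\<And>y. y \<notin> {A..A + 1} \<Longrightarrow> f y = 0) \<Longrightarrow>
       \<exists>w wt wz wtt wtz wzt wzz.
         partials_on {0..T} UNIV w wt wz \<and> partials_on {0..T} UNIV wt wtt wtz \<and>
         partials_on {0..T} UNIV wz wzt wzz \<and>
         (\<forall>t\<in>{0..T}. \<forall>z. wtt t z = wzz t z - \<mu> / z\<^sup>2 * w t z) \<and>
         (\<forall>z. w 0 z = 0 \<and> wt 0 z = f z \<and> wz 0 z = 0) \<and>
         (\<forall>t\<in>{0..T}. \<forall>z. z \<le> m \<or> A + 1 + 2 * T \<le> z \<longrightarrow> w t z = 0 \<and> wz t z = 0)"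
    using compact_wave_exists[OF T, of m \<mu>] by blast
  define a b where "a = \<xi> (A + 1)" and "b = \<xi> A"
  have ab: "0 < a" "a < b" "b < 1"
  proof -
    have "\<xi> m = 1" using \<kappa> by (simp add: \<xi>_def m_def)
    then show "b < 1" using \<xi>_less[of m A] A m by (simp add: b_def)
    show "0 < a" "a < b" using \<zeta>\<xi>(2)[of "A + 1"] \<xi>_less[of A "A + 1"] A by (auto simp: a_def b_def)
  qed
  define \<phi> where "\<phi> = (\<lambda>x. flat 0 (x - a) * flat 0 (b - x))"
  obtain \<phi>' \<phi>'' where d\<phi>: "\<And>x. (\<phi> has_real_derivative \<phi>' x) (at x)" and
    d\<phi>': "\<And>x. (\<phi>' has_real_derivative \<phi>'' x) (at x)"
  proof -
    obtain g where g: "bump_span a b g" "\<forall>x. (\<phi> has_real_derivative g x) (at x)"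
      using bump_span_deriv[OF bump_span.gen[of a b 0 0]] unfolding \<phi>_def by blast
    with bump_span_deriv[OF g(1)] that show ?thesis by blast
  qed
  have \<phi>_zero: "\<phi> x = 0" if "x \<le> a \<or> b \<le> x" for x
    using that by (auto simp: \<phi>_def flat_def)
  \<comment> \<open>\<open>F y\<close> is \<open>x powr (\<theta> / 4) * \<phi> x\<close> at \<open>x = \<xi> y\<close>; it is cut off to \<open>(l,h)\<close> below because it is
    meaningful for positive \<open>y\<close> only.\<close>
  define F where "F = (\<lambda>y. (\<kappa> * y) powr (- m * \<theta> / 4) * \<phi> (\<xi> y))"
  define F' where "F' = (\<lambda>y. (- m * \<theta> / 4) * (\<kappa> * y) powr (- m * \<theta> / 4 - 1) * \<kappa> * \<phi> (\<xi> y)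
      + (\<kappa> * y) powr (- m * \<theta> / 4) * (\<phi>' (\<xi> y) * (- m * (\<kappa> * y) powr (- m - 1) * \<kappa>)))"
  define l h where "l = A / 2" and "h = A + 2"
  have F_zero: "F y = 0" if "0 < y" "y < A \<or> A + 1 < y" for y
  proof -
    have "\<xi> y \<le> a \<or> b \<le> \<xi> y"
      using that \<xi>_less[of y A] \<xi>_less[of "A + 1" y] A unfolding a_def b_def by auto
    then show ?thesis using \<phi>_zero by (simp add: F_def)
  qed
  have dF: "(F has_real_derivative F' y) (at y within S)" if "y > 0" for y S
  proof -
    have "(\<xi> has_real_derivative - m * (\<kappa> * y) powr (- m - 1) * \<kappa>) (at y within S)"
      unfolding \<xi>_def using that \<kappa> by (auto intro!: derivative_eq_intros)
    from DERIV_chain2[OF d\<phi> this]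
    have 1: "((\<lambda>y. \<phi> (\<xi> y)) has_real_derivative \<phi>' (\<xi> y) * (- m * (\<kappa> * y) powr (- m - 1) * \<kappa>)) (at y within S)" .
    have "((\<lambda>y. (\<kappa> * y) powr (- m * \<theta> / 4)) has_real_derivative
        (- m * \<theta> / 4) * (\<kappa> * y) powr (- m * \<theta> / 4 - 1) * \<kappa>) (at y within S)"
      using that \<kappa> by (auto intro!: derivative_eq_intros)
    from DERIV_mult[OF this 1] show ?thesis
      unfolding F_def F'_def by (rule DERIV_cong) (simp add: mult_ac)
  qed
  have cF': "continuous_on {0<..} F'"
  proof -
    have c: "continuous_on UNIV \<phi>" "continuous_on UNIV \<phi>'"
      by (auto intro!: continuous_at_imp_continuous_on DERIV_isCont[OF d\<phi>] DERIV_isCont[OF d\<phi>'])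
    have c\<xi>: "continuous_on {0<..} \<xi>"
      unfolding \<xi>_def using \<kappa> by (auto intro!: continuous_intros)
    show ?thesis
      unfolding F'_def using \<kappa>
      by (auto intro!: continuous_intros continuous_on_compose2[OF c(1) c\<xi>] continuous_on_compose2[OF c(2) c\<xi>])
  qed
  have pF: "partials_on {0..T} {l<..<h} (\<lambda>_. F) (\<lambda>_ _. 0) (\<lambda>_. F')"
  proof -
    have sub: "{l<..<h} \<subseteq> {0<..}" using A by (auto simp: l_def)
    have "continuous_on ({0..T} \<times> {l<..<h}) (\<lambda>s. g (snd s))" if "continuous_on {0<..} g" for g :: "real \<Rightarrow> real"
      by (rule continuous_on_compose2[OF that]) (use sub in \<open>auto intro!: continuous_intros\<close>)
    moreover have "continuous_on {0<..} F"
      by (rule DERIV_continuous_on) (use dF in auto)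
    ultimately show ?thesis
      unfolding partials_on_def case_prod_unfold using dF cF' sub by auto
  qed
  have lh: "l < A" "A + 1 < h" using A by (auto simp: l_def h_def)
  have F0: "F x = 0" if "t \<in> {0..T}" "l < x" "x < h" "x < A \<or> A + 1 < x" for t x :: real
    using that A by (intro F_zero) (auto simp: l_def)
  define f where "f = (\<lambda>y. if l < y \<and> y < h then F y else 0)"
  define f' where "f' = (\<lambda>y. if l < y \<and> y < h then F' y else 0)"
  have ef: "partials_on {0..T} UNIV (\<lambda>_. f) (\<lambda>_ _. 0) (\<lambda>_. f')"
  proof -
    have "partials_on {0..T} UNIV (\<lambda>t y. if l < y \<and> y < h then F y else 0)
        (\<lambda>t y. if l < y \<and> y < h then 0 else 0) (\<lambda>t y. if l < y \<and> y < h then F' y else 0)"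
      by (rule partials_on_extend_0(1)[OF pF T lh]) (rule F0; assumption)
    then show ?thesis by (simp add: f_def f'_def)
  qed
  have T0: "0 \<in> {0..T}" using T by simp
  have df: "(f has_real_derivative f' y) (at y)" for y
    by (rule partials_onD(2)[OF ef T0 UNIV_I])
  have cf': "continuous_on UNIV f'"
    by (rule continuous_on_compose_pair[OF partials_onD(5)[OF ef] continuous_on_const continuous_on_id])
      (use T0 in auto)
  have f_zero: "f y = 0" if "y \<notin> {A..A + 1}" for y
    using that F0[of 0 y] T by (auto simp: f_def)
  obtain w wt wz wtt wtz wzt wzz where
    w: "partials_on {0..T} UNIV w wt wz" and wt: "partials_on {0..T} UNIV wt wtt wtz" and
    wz: "partials_on {0..T} UNIV wz wzt wzz" and
    pde: "\<forall>t\<in>{0..T}. \<forall>z. wtt t z = wzz t z - \<mu> / z\<^sup>2 * w t z" and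
    ic: "\<forall>z. w 0 z = 0 \<and> wt 0 z = f z \<and> wz 0 z = 0" and
    supp: "\<forall>t\<in>{0..T}. \<forall>z. z \<le> m \<or> A + 1 + 2 * T \<le> z \<longrightarrow> w t z = 0 \<and> wz t z = 0"
    using wave[OF df cf' f_zero] by blast
  define \<alpha> where "\<alpha> = - \<theta> / 4"
  let ?B = "{0<..1::real}"
  define u where "u = (\<lambda>t x. x powr \<alpha> * w t (\<zeta> x))"
  define p where "p = (\<lambda>t x. x powr \<alpha> * wt t (\<zeta> x))"
  define q where "q = (\<lambda>t x. \<alpha> * x powr (\<alpha> - 1) * w t (\<zeta> x) + - (x powr (\<alpha> - \<theta> / 2)) * wz t (\<zeta> x))"
  define ptt where "ptt = (\<lambda>t x. x powr \<alpha> * wtt t (\<zeta> x))"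
  define qx where "qx = (\<lambda>t x. (\<alpha> * ((\<alpha> - 1) * x powr (\<alpha> - 1 - 1)) * w t (\<zeta> x)
       + \<alpha> * x powr (\<alpha> - 1) * - (x powr (- \<theta> / 2)) * wz t (\<zeta> x))
     + (- ((\<alpha> - \<theta> / 2) * x powr (\<alpha> - \<theta> / 2 - 1)) * wz t (\<zeta> x)
       + - (x powr (\<alpha> - \<theta> / 2)) * - (x powr (- \<theta> / 2)) * wzz t (\<zeta> x)))"
  have d_pow: "((\<lambda>x. c * x powr r) has_real_derivative c * (r * x powr (r - 1))) (at x within ?B)"
    if "x \<in> ?B" for c r x :: real
    using that by (auto intro!: derivative_eq_intros)
  have d\<zeta>': "(\<zeta> has_real_derivative - (x powr (- \<theta> / 2))) (at x within ?B)" if "x \<in> ?B" for x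
    using d\<zeta> that by auto
  have c\<zeta>': "continuous_on ?B (\<lambda>x. - (x powr (- \<theta> / 2)))"
    by (auto intro!: continuous_intros)
  have comp: "partials_on {0..T} ?B (\<lambda>t x. c * x powr r * W t (\<zeta> x)) (\<lambda>t x. c * x powr r * P t (\<zeta> x))
      (\<lambda>t x. c * (r * x powr (r - 1)) * W t (\<zeta> x) + c * x powr r * - (x powr (- \<theta> / 2)) * Q t (\<zeta> x))"
    if "partials_on {0..T} UNIV W P Q" for W P Q c r
  proof (rule partials_on_compose[OF that])
    show "continuous_on ?B (\<lambda>x. c * (r * x powr (r - 1)))"
      by (auto intro!: continuous_intros)
  qed (use d_pow d\<zeta>' c\<zeta>' in auto)
  have pu: "partials_on {0..T} ?B u p q"
  proof (rule partials_on_cong[OF comp[OF w, of 1 \<alpha>]])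
    fix t x assume "x \<in> ?B"
    then have "x powr \<alpha> * x powr (- \<theta> / 2) = x powr (\<alpha> - \<theta> / 2)"
      by (simp add: powr_add[symmetric])
    then show "1 * (\<alpha> * x powr (\<alpha> - 1)) * w t (\<zeta> x) + 1 * x powr \<alpha> * - (x powr (- \<theta> / 2)) * wz t (\<zeta> x) = q t x"
      by (simp add: q_def)
  qed (auto simp: u_def p_def)
  have pp: "partials_on {0..T} ?B p ptt (\<lambda>t x. 1 * (\<alpha> * x powr (\<alpha> - 1)) * wt t (\<zeta> x)
      + 1 * x powr \<alpha> * - (x powr (- \<theta> / 2)) * wtz t (\<zeta> x))"
    by (rule partials_on_cong[OF comp[OF wt, of 1 \<alpha>]]) (auto simp: p_def ptt_def)
  have pq: "partials_on {0..T} ?B q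
     (\<lambda>t x. \<alpha> * x powr (\<alpha> - 1) * wt t (\<zeta> x) + - 1 * x powr (\<alpha> - \<theta> / 2) * wzt t (\<zeta> x)) qx"
    by (rule partials_on_cong[OF partials_on_add[OF comp[OF w, of \<alpha> "\<alpha> - 1"] comp[OF wz, of "-1" "\<alpha> - \<theta> / 2"]]])
      (auto simp: q_def qx_def)
  note du = strip_derivatives[OF T pu]
  have pdt: "partials_on {0..T} ?B (dt T u) ptt (\<lambda>t x. 1 * (\<alpha> * x powr (\<alpha> - 1)) * wt t (\<zeta> x)
      + 1 * x powr \<alpha> * - (x powr (- \<theta> / 2)) * wtz t (\<zeta> x))"
    by (rule partials_on_cong[OF pp]) (auto simp: du)
  have pdx: "partials_on {0..T} ?B (dx u)
     (\<lambda>t x. \<alpha> * x powr (\<alpha> - 1) * wt t (\<zeta> x) + - 1 * x powr (\<alpha> - \<theta> / 2) * wzt t (\<zeta> x)) qx"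
    by (rule partials_on_cong[OF pq]) (auto simp: du)
  have C2: "C2_on_strip T u"
    unfolding C2_on_strip_def using C1_on_stripI[OF T] pu pdt pdx by blast
  have wave_eq: "ptt t x = x powr \<theta> * qx t x + \<theta> * x powr (\<theta> - 1) * q t x"
    if t: "t \<in> {0..T}" and x: "x > 0" for t x
  proof -
    \<comment> \<open>All powers of \<open>x\<close> are monomials in \<open>x\<close>, \<open>s\<close> and \<open>X\<close>, which reduces the claim to rational algebra.\<close>
    define s X where "s = x powr (\<theta> / 2)" and "X = x powr \<alpha>"
    have s: "s > 0" using x by (simp add: s_def)
    have pows: "x powr \<theta> = s\<^sup>2" "x powr (- \<theta> / 2) = 1 / s" "x powr (\<alpha> - 1) = X / x"
      "x powr (\<alpha> - 1 - 1) = X / x\<^sup>2" "x powr (\<alpha> - \<theta> / 2) = X / s" "x powr (\<alpha> - \<theta> / 2 - 1) = X / (s * x)"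
      "x powr (\<theta> - 1) = s\<^sup>2 / x"
      using x by (simp_all add: s_def X_def powr_diff powr_minus_divide powr_add[symmetric] power2_eq_square)
    have "x powr (- \<kappa>) = x / s"
    proof -
      have "- \<kappa> = 1 - \<theta> / 2" by (simp add: \<kappa>_def)
      then show ?thesis using x by (simp add: s_def powr_diff)
    qed
    then have pot: "\<mu> / (\<zeta> x)\<^sup>2 = \<theta> / 4 * (3 * \<theta> / 4 - 1) * s\<^sup>2 / x\<^sup>2"
      using \<kappa> x s by (simp add: \<mu>_def \<zeta>_def m_def power_divide power2_eq_square)
    have "ptt t x = X * (wzz t (\<zeta> x) - \<mu> / (\<zeta> x)\<^sup>2 * w t (\<zeta> x))"
      using pde t by (simp add: ptt_def X_def)
    also have "\<dots> = X * (wzz t (\<zeta> x) - \<theta> / 4 * (3 * \<theta> / 4 - 1) * s\<^sup>2 / x\<^sup>2 * w t (\<zeta> x))"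
      by (simp only: pot)
    also have "\<dots> = s\<^sup>2 * qx t x + \<theta> * (s\<^sup>2 / x) * q t x"
      unfolding qx_def q_def pows using x s
      by (simp add: \<alpha>_def field_simps power2_eq_square)
    finally show ?thesis by (simp only: pows)
  qed
  have dt0: "dt T u 0 x = \<phi> x" if x: "x \<in> {0<..<1}" for x
  proof -
    have x0: "x > 0" using x by simp
    have "dt T u 0 x = x powr \<alpha> * f (\<zeta> x)"
      using x T ic by (subst du) (auto simp: p_def)
    also have "\<dots> = \<phi> x"
    proof (cases "l < \<zeta> x \<and> \<zeta> x < h")
      case True
      have "\<kappa> * \<zeta> x = x powr (- \<kappa>)" using \<kappa> by (simp add: \<zeta>_def)
      then have "(\<kappa> * \<zeta> x) powr (- m * \<theta> / 4) = x powr (\<theta> / 4)"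
        using \<kappa> by (simp add: powr_powr m_def)
      then show ?thesis
        using True x0 \<xi>\<zeta>[OF x0] by (simp add: f_def F_def \<alpha>_def powr_add[symmetric])
    next
      case False
      then have "\<zeta> x < A \<or> A + 1 < \<zeta> x" using lh by auto
      then have "x \<le> a \<or> b \<le> x"
        using \<xi>_less[of "\<zeta> x" A] \<xi>_less[of "A + 1" "\<zeta> x"] \<xi>\<zeta>[OF x0] A by (auto simp: a_def b_def)
      then show ?thesis using False \<phi>_zero[of x] by (auto simp: f_def)
    qed
    finally show ?thesis .
  qed
  have \<zeta>1: "\<zeta> 1 = m" by (simp add: \<zeta>_def m_def)
  show ?thesis
  proof (rule that[of \<phi> u])
    show "test_function \<phi>"
      unfolding \<phi>_def by (rule test_function_bump[OF ab])
    show "\<exists>x\<in>{0<..<1}. \<phi> x \<noteq> 0"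
      by (rule bexI[of _ "(a + b) / 2"]) (use ab in \<open>auto simp: \<phi>_def flat_def\<close>)
    show "dx u t 1 = 0" if "t \<in> {0..T}" for t
      using supp that by (subst du) (auto simp: q_def \<zeta>1)
    show "dt T u 0 x = \<phi> x \<and> dx u 0 x = 0" if "x \<in> {0<..<1}" for x
      using dt0[OF that] that T ic by (auto simp: du q_def)
    show "classical_solution T \<theta> (\<lambda>_. 0) \<phi> u"
      unfolding classical_solution_def
    proof (intro conjI ballI)
      fix t x assume t: "t \<in> {0<..<T}" and x: "x \<in> {0<..<1::real}"
      have t': "t \<in> {0..T}" and x': "x \<in> ?B" using t x by auto
      have "dt T (dt T u) t x = ptt t x"
        by (rule strip_derivatives[OF T pdt t' x'])
      moreover have "dx (\<lambda>s y. y powr \<theta> * dx u s y) t x = x powr \<theta> * qx t x + \<theta> * x powr (\<theta> - 1) * q t x"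
        using dx_flux[OF pdx t' x] du(2)[OF t' x'] by simp
      ultimately show "dt T (dt T u) t x - dx (\<lambda>s y. y powr \<theta> * dx u s y) t x = 0"
        using wave_eq[OF t'] x by simp
    next
      fix t assume t: "t \<in> {0<..<T}"
      then have t': "t \<in> {0..T}" by auto
      show "u t 1 = 0" using supp t' by (auto simp: u_def \<zeta>1)
      define c where "c = min 1 (\<xi> (A + 1 + 2 * T))"
      have c: "c > 0" using \<zeta>\<xi>(2)[of "A + 1 + 2 * T"] A T by (simp add: c_def)
      have "x powr \<theta> * dx u t x = 0" if "0 < x" "x < c" for x
      proof -
        have "\<zeta> (\<xi> (A + 1 + 2 * T)) \<le> \<zeta> x" using that by (intro \<zeta>_le) (auto simp: c_def)
        then have "A + 1 + 2 * T \<le> \<zeta> x" using \<zeta>\<xi>(1)[of "A + 1 + 2 * T"] A T by simp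
        then have "q t x = 0" using supp t' by (simp add: q_def)
        moreover have "x \<in> ?B" using that by (auto simp: c_def)
        ultimately show ?thesis using du(2)[OF t'] by simp
      qed
      then have "\<forall>\<^sub>F x in at_right 0. 0 = x powr \<theta> * dx u t x"
        unfolding eventually_at_right_field using c by (intro exI[of _ c]) auto
      then show "((\<lambda>x. x powr \<theta> * dx u t x) \<longlongrightarrow> 0) (at_right 0)"
        by (rule Lim_transform_eventually[OF tendsto_const])
    next
      fix x assume "x \<in> {0<..<1::real}"
      then show "u 0 x = 0" "dt T u 0 x = \<phi> x"
        using ic dt0 by (auto simp: u_def)
    qed (rule C2)
  qed
qed

lemma energy_pos:
  assumes u1: "test_function u1" "\<exists>x\<in>{0<..<1}. u1 x \<noteq> 0"
    and ic: "\<And>x. x \<in> {0<..<1} \<Longrightarrow> dt T u 0 x = u1 x \<and> dx u 0 x = 0"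
  shows "energy T \<theta> u 0 > 0"
proof -
  have "u1 differentiable (at x)" for x
    using u1(1) unfolding test_function_def by (metis funpow_0)
  then have c: "continuous_on {0..1} (\<lambda>x. (u1 x)\<^sup>2)"
    by (auto intro!: continuous_intros continuous_at_imp_continuous_on differentiable_imp_continuous_within)
  have "integral {0<..<1} (\<lambda>x. (dt T u 0 x)\<^sup>2 + x powr \<theta> * (dx u 0 x)\<^sup>2)
      = integral {0<..<1} (\<lambda>x. (u1 x)\<^sup>2)"
    by (rule integral_cong) (simp add: ic)
  also have "\<dots> = integral {0..1} (\<lambda>x. (u1 x)\<^sup>2)"
    by (simp add: integral_open_interval_real)
  also have "\<dots> > 0"
  proof -
    have "integral {0..1} (\<lambda>x. (u1 x)\<^sup>2) \<noteq> 0"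
      using integral_eq_0_iff[OF c] u1(2) by fastforce
    moreover have "integral {0..1} (\<lambda>x. (u1 x)\<^sup>2) \<ge> 0"
      by (intro integral_nonneg integrable_continuous_real c) auto
    ultimately show ?thesis by simp
  qed
  finally show ?thesis by (simp add: energy_def)
qed

theorem mainTheorem5:
  fixes T \<theta> :: real
  assumes "T > 0" and "\<theta> > 2"
  shows "(\<exists>u0 u1 u.
            test_function u0 \<and> test_function u1 \<and>
            \<not> ((\<forall>x\<in>{0<..<1}. u0 x = 0) \<and> (\<forall>x\<in>{0<..<1}. u1 x = 0)) \<and>
            classical_solution T \<theta> u0 u1 u \<and>
            (\<forall>v. classical_solution T \<theta> u0 u1 v \<longrightarrow>
                   (\<forall>t\<in>{0..T}. \<forall>x\<in>{0<..1}. v t x = u t x)) \<and>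
            (\<forall>t\<in>{0..T}. dx u t 1 = 0)) \<and>
         \<not> (\<exists>C>0. \<forall>u0 u1 u.
               test_function u0 \<longrightarrow> test_function u1 \<longrightarrow> classical_solution T \<theta> u0 u1 u \<longrightarrow>
               integral {0..T} (\<lambda>t. (dx u t 1)\<^sup>2) \<ge> C * energy T \<theta> u 0)"
proof -
  obtain u1 u where u1: "test_function u1" "\<exists>x\<in>{0<..<1}. u1 x \<noteq> 0"
    and u: "classical_solution T \<theta> (\<lambda>_. 0) u1 u"
    and silent: "\<And>t. t \<in> {0..T} \<Longrightarrow> dx u t 1 = 0"
    and ic: "\<And>x. x \<in> {0<..<1} \<Longrightarrow> dt T u 0 x = u1 x \<and> dx u 0 x = 0"
    using unobservable_wave[OF assms] by blast
  have "integral {0..T} (\<lambda>t. (dx u t 1)\<^sup>2) = integral {0..T} (\<lambda>_. 0)"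
    by (rule integral_cong) (simp add: silent)
  then have no_C: "\<not> integral {0..T} (\<lambda>t. (dx u t 1)\<^sup>2) \<ge> C * energy T \<theta> u 0" if "C > 0" for C
    using mult_pos_pos[OF that energy_pos[OF u1 ic, of \<theta>]] by simp
  show ?thesis
  proof (rule conjI, rule exI[of _ "\<lambda>_. 0"], rule exI[of _ u1], rule exI[of _ u], intro conjI allI impI ballI)
    show "v t x = u t x" if "classical_solution T \<theta> (\<lambda>_. 0) u1 v" "t \<in> {0..T}" "x \<in> {0<..1}" for v t x
      by (rule classical_solution_unique[OF assms u that])
    show "\<not> ((\<forall>x\<in>{0<..<1::real}. (0::real) = 0) \<and> (\<forall>x\<in>{0<..<1}. u1 x = 0))"
      using u1(2) by blast
    show "\<not> (\<exists>C>0. \<forall>u0 u1 u.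
               test_function u0 \<longrightarrow> test_function u1 \<longrightarrow> classical_solution T \<theta> u0 u1 u \<longrightarrow>
               integral {0..T} (\<lambda>t. (dx u t 1)\<^sup>2) \<ge> C * energy T \<theta> u 0)"
    proof
      assume "\<exists>C>0. \<forall>u0 u1 u.
               test_function u0 \<longrightarrow> test_function u1 \<longrightarrow> classical_solution T \<theta> u0 u1 u \<longrightarrow>
               integral {0..T} (\<lambda>t. (dx u t 1)\<^sup>2) \<ge> C * energy T \<theta> u 0"
      then obtain C where "C > 0" "integral {0..T} (\<lambda>t. (dx u t 1)\<^sup>2) \<ge> C * energy T \<theta> u 0"
        using test_function_0 u1(1) u by meson
      with no_C show False by blast
    qed
  qed (fact test_function_0 u1(1) u silent)+
qed

end
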